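(* Let $\varphi\colon\mathbb R\to\mathbb R$ be a continuous mapping, and suppose that its set of nonlinearity $E(\varphi)$ has nonzero Lebesgue measure. Then there exist a set $A\subseteq\mathbb R$ that contains arbitrarily long arithmetic progressions and a set $B\subseteq\mathbb R$ with distinct sums of pairs such that $\varphi$ maps $A$ bijectively onto $B$ (that is, the restriction of $\varphi$ to $A$ is injective and $\varphi(A)=B$).
   Context: A point $t\in\mathbb R$ is a point of nonlinearity of a mapping $\varphi\colon\mathbb R\to\mathbb R$ if $t$ has no neighborhood in which $\varphi$ coincides with a linear function, where "linear function" means an affine function $u\mapsto \alpha u+\beta$ with $\alpha,\beta\in\mathbb R$. The set of all points of nonlinearity of $\varphi$ is called the set of nonlinearity of $\varphi$ and is denoted by $E(\varphi)$; it is closed. An arithmetic progression of length $N$ is a set $F\subseteq\mathbb R$ of the form $F=\{x+ky : k=1,2,\dots,N\}$, where $x,y\in\mathbb R$ and $y\neq 0$. A set contains arbitrarily long arithmetic progressions if for every positive integer $L$ it contains an arithmetic progression of length $N\ge L$. A set $E\subseteq\mathbb R$ is a set with distinct sums of pairs if a relation $\lambda_1+\lambda_2=\lambda_3+\lambda_4$ with $\lambda_1,\lambda_2,\lambda_3,\lambda_4\in E$ holds only when $\lambda_1=\lambda_3$ and $\lambda_2=\lambda_4$, or $\lambda_1=\lambda_4$ and $\lambda_2=\lambda_3$. *)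

theory Defs
  imports "HOL-Analysis.Analysis"
begin

definition point_of_nonlinearity :: "(real \<Rightarrow> real) \<Rightarrow> real \<Rightarrow> bool" where
  "point_of_nonlinearity \<phi> t \<longleftrightarrow>
     \<not> (\<exists>U. open U \<and> t \<in> U \<and> (\<exists>\<alpha> \<beta>. \<forall>u\<in>U. \<phi> u = \<alpha> * u + \<beta>))"

definition nonlinearity_set :: "(real \<Rightarrow> real) \<Rightarrow> real set" where
  "nonlinearity_set \<phi> = {t. point_of_nonlinearity \<phi> t}"

(* In particular this set is measurable, so its emeasure is its true Lebesgue measure
   and not the default value 0. *)
lemma closed_nonlinearity_set: "closed (nonlinearity_set \<phi>)"
proof -
  have "- nonlinearity_set \<phi> =
      \<Union>{U. open U \<and> (\<exists>\<alpha> \<beta>. \<forall>u\<in>U. \<phi> u = \<alpha> * u + \<beta>)}"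
    unfolding nonlinearity_set_def point_of_nonlinearity_def by blast
  then have "open (- nonlinearity_set \<phi>)"
    by auto
  then show ?thesis
    by (simp add: closed_def)
qed

definition arith_progression :: "nat \<Rightarrow> real set \<Rightarrow> bool" where
  "arith_progression N F \<longleftrightarrow>
     (\<exists>x y. y \<noteq> 0 \<and> F = {x + real k * y | k. k \<in> {1..N}})"

definition arbitrarily_long_progressions :: "real set \<Rightarrow> bool" where
  "arbitrarily_long_progressions A \<longleftrightarrow>
     (\<forall>L>0. \<exists>N\<ge>L. \<exists>F. arith_progression N F \<and> F \<subseteq> A)"

definition distinct_pair_sums :: "real set \<Rightarrow> bool" where
  "distinct_pair_sums E \<longleftrightarrow>
     (\<forall>a\<in>E. \<forall>b\<in>E. \<forall>c\<in>E. \<forall>d\<in>E.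
        a + b = c + d \<longrightarrow> (a = c \<and> b = d) \<or> (a = d \<and> b = c))"

end

theory Submission
  imports Defs
begin

text \<open>
  The set \<open>A\<close> is a union of progressions of lengths 0, 1, 2, \<dots>, added one after the
  other in such a way that \<open>\<phi>\<close> stays injective with distinct sums of pairs. Suppose that a finite
  set has been constructed. A progression \<open>x + k * y\<close>, \<open>1 \<le> k \<le> N\<close>, can be added unless it
  satisfies one of finitely many nontrivial relations
  \<open>(\<Sum>k\<in>{1..N}. c k * \<phi> (x + k * y)) = d\<close> with at most four nonzero coefficients. The claim is
  that, if all progressions with \<open>y \<noteq> 0\<close> satisfied such a relation, then the set \<open>E\<close> of
  nonlinearity would be null (\<open>nonlinearity_set_null\<close>).
  
  First, \<open>E\<close> has empty interior (\<open>interior_nonlinearity_set\<close>). Otherwise, by a Baire argument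
  one relation holds for all \<open>(x, y)\<close> in an open set, with all terms in an interval inside
  \<open>E\<close>. Differencing eliminates all but one term and shows that \<open>\<phi>\<close> has vanishing third
  differences on some interval, so is a quadratic polynomial there; and a quadratic polynomial that
  is not affine satisfies none of the relations on an open set, since numbers with
  \<open>a + b = c + d\<close> and \<open>a\<^sup>2 + b\<^sup>2 = c\<^sup>2 + d\<^sup>2\<close> agree up to order.
  
  So the points at which \<open>\<phi>\<close> is locally affine are dense, and a relation between such points
  is an affine condition on \<open>(x, y)\<close>. If \<open>E\<close> is not null, there is a progression consisting of
  density points of \<open>E\<close>. By induction on the number of terms that are density points, the
  other terms being outside \<open>E\<close>, each such progression and all progressions near it satisfy
  one relation that involves only the terms outside \<open>E\<close>
  (\<open>relation_among_affine_terms\<close>); with all terms in \<open>E\<close> this is absurd. The positive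
  measure enters in the induction step: one term is moved to an arbitrary place close by on its
  right, while the remaining density points are kept density points
  (\<open>common_shift_into_density_points\<close>).
\<close>

section \<open>Elementary tools\<close>

text \<open>
  A Baire argument for finitely many closed sets: if one of them does not contain
  \<open>W\<close>, what it misses is again open and is covered by the remaining ones.
\<close>
lemma finite_closed_cover_contains_ball:
  fixes W :: "'a::metric_space set"
  assumes "finite F" "\<And>S. S \<in> F \<Longrightarrow> closed S" "open W" "W \<noteq> {}" "W \<subseteq> \<Union>F"
  shows "\<exists>S\<in>F. \<exists>p r. 0 < r \<and> ball p r \<subseteq> S \<inter> W"
  using assms
proof (induction F arbitrary: W rule: finite_induct)
  case empty
  then show ?case by auto
next
  case (insert S F)
  show ?case
  proof (cases "W \<subseteq> S")
    case True
    obtain p where "p \<in> W" using insert.prems by auto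
    then obtain r where "r > 0" "ball p r \<subseteq> W"
      using insert.prems openE by blast
    with True show ?thesis by blast
  next
    case False
    have "open (W - S)" "W - S \<noteq> {}" "W - S \<subseteq> \<Union>F"
      using insert.prems False by auto
    moreover have "closed T" if "T \<in> F" for T using insert.prems(1) that by simp
    ultimately obtain T p r where "T \<in> F" "0 < r" "ball p r \<subseteq> T \<inter> (W - S)"
      using insert.IH[of "W - S"] by metis
    then show ?thesis by (intro bexI[of _ T] exI[of _ p] exI[of _ r]) auto
  qed
qed

lemma quadratic_in_two_variables_zero:
  fixes P Q R S T V x0 y0 :: real
  assumes "0 < r"
    and zero: "\<And>x y. \<bar>x - x0\<bar> < r \<Longrightarrow> \<bar>y - y0\<bar> < r \<Longrightarrow>
           P * x\<^sup>2 + Q * x * y + R * y\<^sup>2 + S * x + T * y + V = 0"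
  shows "P = 0 \<and> Q = 0 \<and> R = 0 \<and> S = 0 \<and> T = 0 \<and> V = 0"
proof -
  define h where "h = r / 2"
  have h: "h > 0" "h < r" using assms by (auto simp: h_def)
  have z00: "P * x0\<^sup>2 + Q * x0 * y0 + R * y0\<^sup>2 + S * x0 + T * y0 + V = 0"
    using zero[of x0 y0] h by simp
  have zp0: "P * (x0+h)\<^sup>2 + Q * (x0+h) * y0 + R * y0\<^sup>2 + S * (x0+h) + T * y0 + V = 0"
    using zero[of "x0+h" y0] h by simp
  have zm0: "P * (x0-h)\<^sup>2 + Q * (x0-h) * y0 + R * y0\<^sup>2 + S * (x0-h) + T * y0 + V = 0"
    using zero[of "x0-h" y0] h by simp
  have z0p: "P * x0\<^sup>2 + Q * x0 * (y0+h) + R * (y0+h)\<^sup>2 + S * x0 + T * (y0+h) + V = 0"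
    using zero[of x0 "y0+h"] h by simp
  have z0m: "P * x0\<^sup>2 + Q * x0 * (y0-h) + R * (y0-h)\<^sup>2 + S * x0 + T * (y0-h) + V = 0"
    using zero[of x0 "y0-h"] h by simp
  have zpp: "P * (x0+h)\<^sup>2 + Q * (x0+h) * (y0+h) + R * (y0+h)\<^sup>2 + S * (x0+h) + T * (y0+h) + V = 0"
    using zero[of "x0+h" "y0+h"] h by simp
  have "2 * P * h\<^sup>2 = 0" using z00 zp0 zm0 by algebra
  then have P: "P = 0" using h by simp
  have "2 * R * h\<^sup>2 = 0" using z00 z0p z0m by algebra
  then have R: "R = 0" using h by simp
  have "Q * h\<^sup>2 = 0" using z00 z0p zp0 zpp P R by algebra
  then have Q: "Q = 0" using h by simp
  have "S * h = 0" using z00 zp0 P Q R by algebra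
  then have S: "S = 0" using h by simp
  have "T * h = 0" using z00 z0p P Q R by algebra
  then have T: "T = 0" using h by simp
  show ?thesis using P Q R S T z00 by simp
qed

text \<open>
  The third difference is a linear recurrence. With step \<open>\<eta> / 2^m\<close> it propagates three
  consecutive zeros to all grid points, and when the step is halved the old zeros sit at positions
  0, 2 and 4 of the new grid, which by two instances of the recurrence forces a zero at position 1.
  So \<open>f\<close> vanishes at the dyadic points, and everywhere by continuity.
\<close>
lemma zero_if_third_differences_zero:
  fixes f :: "real \<Rightarrow> real"
  assumes cont: "continuous_on UNIV f" and "0 < \<eta>"
    and diff: "\<And>t h. t0 \<le> t \<Longrightarrow> t < t0 + 4 * \<eta> \<Longrightarrow> 0 < h \<Longrightarrow> h \<le> \<eta> \<Longrightarrow>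
        f (t + 3 * h) - 3 * f (t + 2 * h) + 3 * f (t + h) - f t = 0"
    and zeros: "f t0 = 0" "f (t0 + \<eta>) = 0" "f (t0 + 2 * \<eta>) = 0"
    and t: "t0 \<le> t" "t \<le> t0 + \<eta>"
  shows "f t = 0"
proof -
  have rec: "f (t0 + real (n + 3) * \<eta> / 2^m) =
      3 * f (t0 + real (n + 2) * \<eta> / 2^m) - 3 * f (t0 + real (n + 1) * \<eta> / 2^m) + f (t0 + real n * \<eta> / 2^m)"
    if "n < 4 * 2^m" for n m
  proof -
    have "real n < 4 * 2^m" using that by (metis of_nat_less_iff of_nat_mult of_nat_numeral of_nat_power)
    then have "real n * \<eta> / 2^m < 4 * \<eta>" using \<open>0 < \<eta>\<close> by (simp add: field_simps)
    moreover have "\<eta> / 2^m \<le> \<eta>" using \<open>0 < \<eta>\<close>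
      by (simp add: field_simps)
    ultimately show ?thesis
      using diff[of "t0 + real n * \<eta> / 2^m" "\<eta> / 2^m"] \<open>0 < \<eta>\<close>
      by (simp add: add_divide_distrib distrib_right add_ac)
  qed
  have level: "f (t0 + real n * \<eta> / 2^m) = 0"
    if "f t0 = 0" "f (t0 + \<eta> / 2^m) = 0" "f (t0 + 2 * \<eta> / 2^m) = 0" "n < 4 * 2^m" for n m
    using that(4)
  proof (induction n rule: less_induct)
    case (less n)
    consider "n = 0" | "n = 1" | "n = 2" | k where "n = k + 3"
    proof -
      have "n = 0 \<or> n = 1 \<or> n = 2 \<or> n = (n - 3) + 3" by arith
      then show ?thesis using that by blast
    qed
    then show ?case
    proof cases
      case (4 k)
      have "f (t0 + real (k + j) * \<eta> / 2^m) = 0" if "j < 3" for j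
        by (rule less.IH) (use less.prems 4 that in auto)
      from this[of 0] this[of 1] this[of 2] show ?thesis
        using rec[of k m] less.prems unfolding 4 by simp
    qed (use that in auto)
  qed
  have start: "f (t0 + \<eta> / 2^m) = 0 \<and> f (t0 + 2 * \<eta> / 2^m) = 0" for m
  proof (induction m)
    case 0
    then show ?case using zeros by simp
  next
    case (Suc m)
    let ?g = "\<lambda>n::nat. f (t0 + real n * \<eta> / 2^Suc m)"
    have g: "?g 0 = 0" "?g 2 = 0" "?g 4 = 0" using zeros Suc by (simp_all add: field_simps)
    have "(1::nat) < 4 * 2 ^ Suc m"
      by (rule less_le_trans[of _ "4 * 1"]) (use one_le_power[of "2::nat" "Suc m"] in linarith)+
    then have "?g (0 + 3) = 3 * ?g (0 + 2) - 3 * ?g (0 + 1) + ?g 0"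
      "?g (1 + 3) = 3 * ?g (1 + 2) - 3 * ?g (1 + 1) + ?g 1"
      by (intro rec; simp)+
    then have "?g 3 = 3 * ?g 2 - 3 * ?g 1 + ?g 0" "?g 4 = 3 * ?g 3 - 3 * ?g 2 + ?g 1"
      by (simp_all only: add_0 one_add_one numeral_plus_numeral numeral_plus_one one_plus_numeral semiring_norm)
    then have "?g 1 = 0" using g by linarith
    with g show ?case by simp
  qed
  define u where "u m = t0 + real (nat \<lfloor>(t - t0) / \<eta> * 2^m\<rfloor>) * \<eta> / 2^m" for m :: nat
  have fu: "f (u m) = 0" for m
  proof -
    have "(t - t0) / \<eta> * 2^m \<le> 1 * 2^m" using t \<open>0 < \<eta>\<close> by (intro mult_right_mono) auto
    then have "\<lfloor>(t - t0) / \<eta> * 2^m\<rfloor> \<le> \<lfloor>real (2^m)\<rfloor>"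
      by (intro floor_mono) simp
    then have "nat \<lfloor>(t - t0) / \<eta> * 2^m\<rfloor> \<le> 2^m"
      unfolding floor_of_nat by (simp only: nat_le_iff)
    moreover have "(2::nat)^m > 0" by simp
    ultimately have "nat \<lfloor>(t - t0) / \<eta> * 2^m\<rfloor> < 4 * 2^m" by linarith
    then show ?thesis unfolding u_def using level start zeros by blast
  qed
  have "u \<longlonglongrightarrow> t"
  proof -
    have b: "\<bar>u m - t\<bar> \<le> \<eta> * (1/2)^m" for m
    proof -
      let ?z = "(t - t0) / \<eta> * 2^m"
      have "?z \<ge> 0" using t \<open>0 < \<eta>\<close> by simp
      then have "real (nat \<lfloor>?z\<rfloor>) = of_int \<lfloor>?z\<rfloor>" by simp
      then have e: "\<bar>real (nat \<lfloor>?z\<rfloor>) - ?z\<bar> \<le> 1" by linarith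
      have "u m - t = (real (nat \<lfloor>?z\<rfloor>) - ?z) * (\<eta> / 2^m)"
        unfolding u_def using \<open>0 < \<eta>\<close> by (simp add: field_simps)
      then have "\<bar>u m - t\<bar> = \<bar>real (nat \<lfloor>?z\<rfloor>) - ?z\<bar> * (\<eta> / 2^m)"
        using \<open>0 < \<eta>\<close> by (simp add: abs_mult)
      also have "\<dots> \<le> 1 * (\<eta> / 2^m)" using e \<open>0 < \<eta>\<close> by (intro mult_right_mono) auto
      finally show ?thesis by (simp add: power_one_over)
    qed
    have "(\<lambda>m. \<eta> * (1/2)^m) \<longlonglongrightarrow> \<eta> * 0"
      by (intro tendsto_intros LIMSEQ_power_zero) auto
    then have lim: "(\<lambda>m. \<eta> * (1/2)^m) \<longlonglongrightarrow> 0" by simp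
    have "(\<lambda>m. u m - t) \<longlonglongrightarrow> 0"
      by (rule Lim_null_comparison[OF _ lim]) (use b in auto)
    then show ?thesis by (simp add: LIM_zero_iff)
  qed
  moreover have "isCont f t" using cont by (simp add: continuous_on_eq_continuous_at)
  ultimately have "(\<lambda>m. f (u m)) \<longlonglongrightarrow> f t" by (rule isCont_tendsto_compose[rotated])
  then show ?thesis using fu by (simp add: LIMSEQ_const_iff)
qed

text \<open>
  Third differences of a quadratic polynomial vanish, so the interpolating polynomial at three grid
  points can be subtracted.
\<close>
lemma quadratic_if_third_differences_zero:
  fixes f :: "real \<Rightarrow> real"
  assumes cont: "continuous_on UNIV f" and "0 < \<eta>"
    and diff: "\<And>t h. t0 \<le> t \<Longrightarrow> t < t0 + 4 * \<eta> \<Longrightarrow> 0 < h \<Longrightarrow> h \<le> \<eta> \<Longrightarrow>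
        f (t + 3 * h) - 3 * f (t + 2 * h) + 3 * f (t + h) - f t = 0"
  obtains A B C where "\<And>t. t0 \<le> t \<Longrightarrow> t \<le> t0 + \<eta> \<Longrightarrow> f t = A * t\<^sup>2 + B * t + C"
proof -
  define A where "A = (f (t0 + 2 * \<eta>) - 2 * f (t0 + \<eta>) + f t0) / (2 * \<eta>\<^sup>2)"
  define B where "B = (f (t0 + \<eta>) - f t0) / \<eta> - A * \<eta>"
  define q where "q t = A * (t - t0)\<^sup>2 + B * (t - t0) + f t0" for t
  have A: "A * (2 * \<eta>\<^sup>2) = f (t0 + 2 * \<eta>) - 2 * f (t0 + \<eta>) + f t0"
    unfolding A_def using \<open>0 < \<eta>\<close> by simp
  have B: "B * \<eta> = f (t0 + \<eta>) - f t0 - A * \<eta>\<^sup>2"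
    unfolding B_def using \<open>0 < \<eta>\<close> by (simp add: field_simps power2_eq_square)
  have "f t - q t = 0" if "t0 \<le> t" "t \<le> t0 + \<eta>" for t
  proof (rule zero_if_third_differences_zero[of "\<lambda>t. f t - q t" \<eta> t0, OF _ \<open>0 < \<eta>\<close> _ _ _ _ that])
    show "continuous_on UNIV (\<lambda>t. f t - q t)"
      unfolding q_def by (intro continuous_intros cont)
    fix t h assume "t0 \<le> t" "t < t0 + 4 * \<eta>" "0 < h" "h \<le> \<eta>"
    moreover have "q (t + 3 * h) - 3 * q (t + 2 * h) + 3 * q (t + h) - q t = 0"
      unfolding q_def by (simp add: power2_eq_square algebra_simps)
    ultimately show "f (t + 3 * h) - q (t + 3 * h) - 3 * (f (t + 2 * h) - q (t + 2 * h)) +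
        3 * (f (t + h) - q (t + h)) - (f t - q t) = 0"
      using diff[of t h] by (simp add: algebra_simps)
  next
    show "f t0 - q t0 = 0" by (simp add: q_def)
    show "f (t0 + \<eta>) - q (t0 + \<eta>) = 0" using B by (simp add: q_def)
    show "f (t0 + 2 * \<eta>) - q (t0 + 2 * \<eta>) = 0"
      using A B by (simp add: q_def power2_eq_square algebra_simps)
  qed
  then have "f t = A * t\<^sup>2 + (B - 2 * A * t0) * t + (A * t0\<^sup>2 - B * t0 + f t0)"
    if "t0 \<le> t" "t \<le> t0 + \<eta>" for t
  proof -
    have "f t = q t" using \<open>\<And>t. _ \<Longrightarrow> _ \<Longrightarrow> f t - q t = 0\<close>[OF that] by simp
    then show ?thesis unfolding q_def by algebra
  qed
  then show thesis using that by blast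
qed

section \<open>One-sided density points\<close>
definition right_density_points :: "real set \<Rightarrow> real set" where
  "right_density_points E =
     {t \<in> E. \<forall>\<eta>>0. \<exists>\<delta>>0. \<forall>h. 0 < h \<and> h < \<delta> \<longrightarrow> measure lebesgue ({t..t + h} - E) \<le> \<eta> * h}"

text \<open>
  Lebesgue's differentiation theorem for the indicator function of \<open>E\<close>, for cubes that have
  the given point as a corner. On the line these are the intervals to its right, which is why
  density is one-sided here.
\<close>
lemma negligible_not_right_density_points:
  assumes "closed E"
  shows "negligible (E - right_density_points E)"
proof -
  have EM: "E \<inter> {a..b} \<in> lmeasurable" for a b
    using assms by (intro lmeasurable_compact closed_Int_compact) auto
  have int: "(indicator E :: real \<Rightarrow> real) integrable_on cbox a b" for a b
    using EM[of a b] by (simp add: integrable_on_indicator)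
  obtain N where N: "negligible N"
    and lim: "\<And>x e. x \<notin> N \<Longrightarrow> 0 < e \<Longrightarrow> \<exists>d>0. \<forall>h. 0 < h \<and> h < d \<longrightarrow>
       norm (integral (cbox x (x + h *\<^sub>R One)) (indicator E :: real \<Rightarrow> real) /\<^sub>R h ^ DIM(real) - indicator E x) < e"
    using integrable_ccontinuous_explicit[OF int] by metis
  have "t \<in> right_density_points E" if "t \<in> E" "t \<notin> N" for t
    unfolding right_density_points_def
  proof (intro CollectI conjI allI impI \<open>t \<in> E\<close>)
    fix \<eta> :: real assume "\<eta> > 0"
    then obtain d where "d > 0" and d: "\<And>h. 0 < h \<Longrightarrow> h < d \<Longrightarrow>
       norm (integral (cbox t (t + h *\<^sub>R One)) (indicator E :: real \<Rightarrow> real) /\<^sub>R h ^ DIM(real) - indicator E t) < \<eta>"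
      using lim[OF \<open>t \<notin> N\<close>] by blast
    have "measure lebesgue ({t..t + h} - E) \<le> \<eta> * h" if "0 < h" "h < d" for h
    proof -
      have "integral {t..t+h} (indicator E :: real \<Rightarrow> real) = measure lebesgue (E \<inter> {t..t+h})"
        using EM by (simp add: Equivalence_Lebesgue_Henstock_Integration.integral_indicator)
      then have "\<bar>measure lebesgue (E \<inter> {t..t+h}) / h - 1\<bar> < \<eta>"
        using d[OF that] \<open>t \<in> E\<close> by (simp add: divide_inverse mult.commute)
      then have "1 - \<eta> < measure lebesgue (E \<inter> {t..t+h}) / h" by linarith
      then have "(1 - \<eta>) * h < measure lebesgue (E \<inter> {t..t+h})"
        using \<open>0 < h\<close> by (simp add: pos_less_divide_eq)
      moreover have "measure lebesgue ({t..t + h} - E \<inter> {t..t+h}) =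
          measure lebesgue {t..t + h} - measure lebesgue (E \<inter> {t..t+h})"
        using EM by (intro measurable_measure_Diff) auto
      moreover have "{t..t + h} - E \<inter> {t..t+h} = {t..t + h} - E" by auto
      ultimately show ?thesis using \<open>0 < h\<close> by (simp add: algebra_simps)
    qed
    then show "\<exists>\<delta>>0. \<forall>h. 0 < h \<and> h < \<delta> \<longrightarrow> measure lebesgue ({t..t + h} - E) \<le> \<eta> * h"
      using \<open>d > 0\<close> by blast
  qed
  then show ?thesis by (intro negligible_subset[OF N]) auto
qed

lemma right_density_points_subset: "right_density_points E \<subseteq> E"
  unfolding right_density_points_def by auto

lemma right_density_point_infinite:
  assumes "t \<in> right_density_points E" "0 < \<delta>"
  shows "infinite (E \<inter> {t..t + \<delta>})"
proof
  assume fin: "finite (E \<inter> {t..t + \<delta>})"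
  obtain d where "d > 0" and d: "\<And>h. 0 < h \<Longrightarrow> h < d \<Longrightarrow> measure lebesgue ({t..t + h} - E) \<le> 1/2 * h"
    using assms unfolding right_density_points_def by (smt (verit, best) half_gt_zero_iff mem_Collect_eq zero_less_one)
  define h where "h = min (d / 2) \<delta>"
  have h: "0 < h" "h < d" "h \<le> \<delta>" using \<open>d > 0\<close> assms by (auto simp: h_def)
  have "finite (E \<inter> {t..t + h})" using h by (intro finite_subset[OF _ fin]) auto
  then have "negligible (E \<inter> {t..t + h})" by (rule negligible_finite)
  then have "measure lebesgue ({t..t + h} - E \<inter> {t..t+h}) = measure lebesgue {t..t + h}"
    by (simp add: measure_Diff_null_set negligible_iff_null_sets)
  moreover have "{t..t + h} - E \<inter> {t..t+h} = {t..t + h} - E" by auto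
  ultimately show False using d[of h] h by simp
qed

lemma affine_vimage_lebesgue:
  fixes k c :: real
  assumes "T \<in> lmeasurable" "k \<noteq> 0"
  shows "(\<lambda>s. c + k * s) -` T \<in> lmeasurable"
    and "measure lebesgue ((\<lambda>s. c + k * s) -` T) = measure lebesgue T / \<bar>k\<bar>"
proof -
  have eq: "(\<lambda>s. c + k * s) -` T = (\<lambda>x. (1/k) *\<^sub>R x + (- c / k)) ` T"
  proof (intro equalityI subsetI)
    fix s assume "s \<in> (\<lambda>s. c + k * s) -` T"
    then show "s \<in> (\<lambda>x. (1/k) *\<^sub>R x + (- c / k)) ` T"
      using \<open>k \<noteq> 0\<close> by (intro image_eqI[of _ _ "c + k * s"]) (auto simp: field_simps)
  qed (use \<open>k \<noteq> 0\<close> in \<open>auto simp: field_simps\<close>)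
  show "measure lebesgue ((\<lambda>s. c + k * s) -` T) = measure lebesgue T / \<bar>k\<bar>"
    unfolding eq measure_lebesgue_affine by simp
  have em: "emeasure lebesgue ((\<lambda>s. c + k * s) -` T) < \<infinity>"
    unfolding eq emeasure_lebesgue_affine using assms(1)
    by (simp add: ennreal_mult_less_top fmeasurable_def del: emeasure_completion)
  have "(\<lambda>s. c + k * s) -` T \<inter> space lebesgue \<in> sets lebesgue"
    using lebesgue_affine_measurable[of "\<lambda>_. k" c] assms
    by (intro measurable_sets[of _ lebesgue lebesgue]) auto
  then show "(\<lambda>s. c + k * s) -` T \<in> lmeasurable"
    using em by (intro fmeasurableI) auto
qed

text \<open>
  The points \<open>e k + v + k * s\<close> with \<open>0 < s < v / N\<close> lie within \<open>2 * v\<close> to the right of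
  \<open>e k\<close>, where all but a small proportion of the points are density points again. For each
  \<open>k\<close> the bad values of \<open>s\<close> therefore have measure much smaller than \<open>v / N\<close>, and one
  \<open>s\<close> is good for all \<open>k\<close>. The point is that \<open>v\<close> may be prescribed: one term of a
  progression can be moved to any given place on the right while the other terms are kept in
  the set of density points.
\<close>
lemma common_shift_into_density_points:
  fixes e :: "real \<Rightarrow> real" and N :: real
  assumes "closed E" "finite K" "0 < N"
    and K: "\<And>k. k \<in> K \<Longrightarrow> 1 \<le> \<bar>k\<bar> \<and> \<bar>k\<bar> \<le> N"
    and e: "\<And>k. k \<in> K \<Longrightarrow> e k \<in> right_density_points E"
  shows "\<exists>\<delta>>0. \<forall>v. 0 < v \<and> v < \<delta> \<longrightarrow>
      (\<exists>s. 0 < s \<and> s < v / N \<and> (\<forall>k\<in>K. e k + v + k * s \<in> right_density_points E))"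
proof -
  define D where "D = right_density_points E"
  \<comment> \<open>Chosen so that \<open>card K\<close> exceptional sets of measure \<open>\<eta> * (2 * v)\<close> cannot fill \<open>v / N\<close>.\<close>
  define \<eta> where "\<eta> = 1 / (4 * N * (card K + 1))"
  have "\<eta> > 0" using \<open>0 < N\<close> by (simp add: \<eta>_def)
  have "\<forall>k\<in>K. \<exists>\<delta>>0. \<forall>h. 0 < h \<and> h < \<delta> \<longrightarrow> measure lebesgue ({e k..e k + h} - E) \<le> \<eta> * h"
    using e \<open>\<eta> > 0\<close> unfolding right_density_points_def by blast
  then obtain \<Delta> where \<Delta>: "\<And>k. k \<in> K \<Longrightarrow> 0 < \<Delta> k"
    "\<And>k h. k \<in> K \<Longrightarrow> 0 < h \<Longrightarrow> h < \<Delta> k \<Longrightarrow> measure lebesgue ({e k..e k + h} - E) \<le> \<eta> * h"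
    by metis
  define \<delta> where "\<delta> = Min (insert 1 (\<Delta> ` K)) / 2"
  have "\<delta> > 0" using \<Delta>(1) \<open>finite K\<close> unfolding \<delta>_def by (auto simp: Min_gr_iff)
  have \<delta>: "2 * \<delta> \<le> \<Delta> k" if "k \<in> K" for k
    using that \<open>finite K\<close> by (simp add: \<delta>_def)
  have "\<exists>s. 0 < s \<and> s < v / N \<and> (\<forall>k\<in>K. e k + v + k * s \<in> D)" if v: "0 < v" "v < \<delta>" for v
  proof (rule ccontr)
    assume none: "\<not> ?thesis"
    define T where "T k = {e k..e k + 2 * v} - D" for k
    define B where "B k = (\<lambda>s. (e k + v) + k * s) -` T k" for k
    have TM: "T k \<in> lmeasurable" "measure lebesgue (T k) \<le> \<eta> * (2 * v)" if "k \<in> K" for k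
    proof -
      let ?Z = "{e k..e k + 2 * v} \<inter> (E - D)"
      have Z: "negligible ?Z"
        using negligible_not_right_density_points[OF \<open>closed E\<close>] unfolding D_def
        by (rule negligible_subset) auto
      have eq: "T k = ({e k..e k + 2 * v} - E) \<union> ?Z"
        using right_density_points_subset[of E] unfolding T_def D_def by auto
      have M: "{e k..e k + 2 * v} - E \<in> lmeasurable"
        using \<open>closed E\<close> by (intro fmeasurable_Diff) auto
      show "T k \<in> lmeasurable" unfolding eq
        using M Z negligible_imp_measurable by (intro fmeasurable.Un) auto
      have "measure lebesgue (T k) \<le> measure lebesgue ({e k..e k + 2 * v} - E) + measure lebesgue ?Z"
        unfolding eq using M Z negligible_imp_measurable by (intro measure_Un_le) auto
      also have "measure lebesgue ?Z = 0" using Z negligible_imp_measure0 by blast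
      finally show "measure lebesgue (T k) \<le> \<eta> * (2 * v)"
        using \<Delta>(2)[OF that, of "2 * v"] \<delta>[OF that] v by simp
    qed
    have BM: "B k \<in> lmeasurable" "measure lebesgue (B k) \<le> \<eta> * (2 * v)" if "k \<in> K" for k
    proof -
      have k: "1 \<le> \<bar>k\<bar>" using K that by blast
      then have "k \<noteq> 0" by auto
      show "B k \<in> lmeasurable"
        unfolding B_def by (rule affine_vimage_lebesgue(1)[OF TM(1)[OF that] \<open>k \<noteq> 0\<close>])
      have "measure lebesgue (B k) = measure lebesgue (T k) / \<bar>k\<bar>"
        unfolding B_def by (rule affine_vimage_lebesgue(2)[OF TM(1)[OF that] \<open>k \<noteq> 0\<close>])
      also have "\<dots> \<le> measure lebesgue (T k) / 1"
        using k by (intro divide_left_mono) auto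
      finally show "measure lebesgue (B k) \<le> \<eta> * (2 * v)" using TM(2)[OF that] by simp
    qed
    have "{0<..<v / N} \<subseteq> (\<Union>k\<in>K. B k)"
    proof
      fix s assume s: "s \<in> {0<..<v / N}"
      then obtain k where k: "k \<in> K" "e k + v + k * s \<notin> D" using none by auto
      have "\<bar>k * s\<bar> \<le> N * (v / N)"
        unfolding abs_mult using K[OF k(1)] s by (intro mult_mono) auto
      then have "\<bar>k * s\<bar> \<le> v" using \<open>0 < N\<close> by simp
      then have "s \<in> B k" using k(2) unfolding B_def T_def by (auto simp: abs_le_iff)
      then show "s \<in> (\<Union>k\<in>K. B k)" using k(1) by blast
    qed
    then have "measure lebesgue {0<..<v / N} \<le> measure lebesgue (\<Union>k\<in>K. B k)"
      using BM(1) \<open>finite K\<close> by (intro measure_mono_fmeasurable fmeasurable.finite_UN) auto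
    also have "\<dots> \<le> (\<Sum>k\<in>K. measure lebesgue (B k))"
      using BM(1) \<open>finite K\<close> by (intro measure_UNION_le) auto
    also have "\<dots> \<le> real (card K) * (\<eta> * (2 * v))"
      using sum_bounded_above[of K "\<lambda>k. measure lebesgue (B k)" "\<eta> * (2 * v)"] BM(2) by simp
    also have "\<dots> < v / N"
    proof -
      have "real (card K) * 2 < 4 * (real (card K) + 1)" by simp
      then show ?thesis using v \<open>0 < N\<close> unfolding \<eta>_def by (simp add: field_simps add_pos_nonneg)
    qed
    finally show False using v \<open>0 < N\<close> by simp
  qed
  then show ?thesis using \<open>\<delta> > 0\<close> unfolding D_def by blast
qed

section \<open>The set of nonlinearity\<close>
lemma not_in_nonlinearity_set_iff:
  "t \<notin> nonlinearity_set \<phi> \<longleftrightarrow> (\<exists>\<alpha> \<beta> r. 0 < r \<and> (\<forall>u. \<bar>u - t\<bar> < r \<longrightarrow> \<phi> u = \<alpha> * u + \<beta>))"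
proof
  assume "t \<notin> nonlinearity_set \<phi>"
  then obtain U \<alpha> \<beta> where U: "open U" "t \<in> U" "\<forall>u\<in>U. \<phi> u = \<alpha> * u + \<beta>"
    unfolding nonlinearity_set_def point_of_nonlinearity_def by blast
  then obtain r where "r > 0" "ball t r \<subseteq> U" using openE by blast
  then show "\<exists>\<alpha> \<beta> r. 0 < r \<and> (\<forall>u. \<bar>u - t\<bar> < r \<longrightarrow> \<phi> u = \<alpha> * u + \<beta>)"
    using U(3) by (intro exI[of _ \<alpha>] exI[of _ \<beta>] exI[of _ r]) (auto simp: subset_eq dist_real_def abs_minus_commute)
next
  assume "\<exists>\<alpha> \<beta> r. 0 < r \<and> (\<forall>u. \<bar>u - t\<bar> < r \<longrightarrow> \<phi> u = \<alpha> * u + \<beta>)"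
  then obtain \<alpha> \<beta> r where "0 < r" "\<forall>u. \<bar>u - t\<bar> < r \<longrightarrow> \<phi> u = \<alpha> * u + \<beta>" by blast
  then have "open (ball t r) \<and> t \<in> ball t r \<and> (\<exists>\<alpha> \<beta>. \<forall>u\<in>ball t r. \<phi> u = \<alpha> * u + \<beta>)"
    by (auto simp: dist_real_def abs_minus_commute)
  then show "t \<notin> nonlinearity_set \<phi>"
    unfolding nonlinearity_set_def point_of_nonlinearity_def by blast
qed

text \<open>
  Away from the finitely many crossing points of the lines, continuity prevents \<open>\<phi>\<close> from
  changing the line.
\<close>
lemma finite_nonlinearity_set_if_graph_in_lines:
  assumes cont: "continuous_on UNIV \<phi>" and "open I" "finite L"
    and lines: "\<And>u. u \<in> I \<Longrightarrow> \<exists>(\<alpha>, \<beta>)\<in>L. \<phi> u = \<alpha> * u + \<beta>"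
  shows "finite (nonlinearity_set \<phi> \<inter> I)"
proof -
  define X where "X = (\<Union>(p, q)\<in>L \<times> L - Id. {u. fst p * u + snd p = fst q * u + snd q})"
  have "finite {u. fst p * u + snd p = fst q * u + snd q}" if "p \<noteq> q" for p q :: "real \<times> real"
  proof (cases "fst p = fst q")
    case True
    with that have "snd p \<noteq> snd q" by (simp add: prod_eq_iff)
    with True show ?thesis by simp
  next
    case False
    then have "{u. fst p * u + snd p = fst q * u + snd q} \<subseteq> {(snd q - snd p) / (fst p - fst q)}"
      by (auto simp: field_simps)
    then show ?thesis by (rule finite_subset) simp
  qed
  then have "finite X" unfolding X_def using \<open>finite L\<close> by (intro finite_UN_I) auto
  have "u \<notin> nonlinearity_set \<phi>" if u: "u \<in> I" "u \<notin> X" for u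
  proof -
    obtain \<alpha> \<beta> where l: "(\<alpha>, \<beta>) \<in> L" "\<phi> u = \<alpha> * u + \<beta>" using lines u by blast
    define U where "U = I - (\<Union>q\<in>L - {(\<alpha>, \<beta>)}. {w. \<phi> w = fst q * w + snd q})"
    have "closed {w. \<phi> w = fst q * w + snd q}" for q
      by (intro closed_Collect_eq continuous_intros cont)
    then have "open U" unfolding U_def using \<open>open I\<close> \<open>finite L\<close> by (intro open_Diff closed_UN) auto
    moreover have "u \<in> U" using u l unfolding U_def X_def by fastforce
    moreover have "\<phi> w = \<alpha> * w + \<beta>" if "w \<in> U" for w
    proof -
      obtain q where "q \<in> L" "\<phi> w = fst q * w + snd q"
        using lines[of w] \<open>w \<in> U\<close> unfolding U_def by auto
      with \<open>w \<in> U\<close> have "q = (\<alpha>, \<beta>)" unfolding U_def by blast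
      with \<open>\<phi> w = fst q * w + snd q\<close> show ?thesis by simp
    qed
    ultimately show ?thesis unfolding nonlinearity_set_def point_of_nonlinearity_def by blast
  qed
  then have "nonlinearity_set \<phi> \<inter> I \<subseteq> X" by blast
  then show ?thesis using \<open>finite X\<close> finite_subset by blast
qed

section \<open>Relations that hold for all small perturbations of a progression\<close>
definition combination :: "(real \<Rightarrow> real) \<Rightarrow> nat \<Rightarrow> (nat \<Rightarrow> real) \<Rightarrow> real \<Rightarrow> real \<Rightarrow> real" where
  "combination \<phi> N c x y = (\<Sum>k\<in>{1..N}. c k * \<phi> (x + real k * y))"

definition box_related :: "(real \<Rightarrow> real) \<Rightarrow> nat \<Rightarrow> (nat \<Rightarrow> real) \<Rightarrow> real \<Rightarrow> real \<Rightarrow> real \<Rightarrow> real \<Rightarrow> bool" where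
  "box_related \<phi> N c d x0 y0 r \<longleftrightarrow>
     (\<forall>x y. \<bar>x - x0\<bar> < r \<longrightarrow> \<bar>y - y0\<bar> < r \<longrightarrow> combination \<phi> N c x y = d)"

text \<open>
  Moving \<open>(x, y)\<close> to \<open>(x - k' * s, y + s)\<close> leaves the term number \<open>k'\<close> of the progression in
  place and shifts the term number \<open>k\<close> by \<open>(k - k') * s\<close>. Taking differences of the relation
  in three such directions eliminates three of its at most four terms, and what remains is a third
  difference of \<open>\<phi>\<close> near the term number \<open>k0\<close>.
\<close>
lemma third_differences_zero:
  assumes box: "box_related \<phi> N c d x0 y0 r" and "0 < r"
    and k0: "k0 \<in> {1..N}" "c k0 \<noteq> 0"
    and four: "card {k\<in>{1..N}. c k \<noteq> 0} \<le> 4"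
  shows "\<exists>\<delta>>0. \<forall>t h. \<bar>t - (x0 + real k0 * y0)\<bar> < \<delta> \<longrightarrow> \<bar>h\<bar> < \<delta> \<longrightarrow>
    \<phi> (t + 3 * h) - 3 * \<phi> (t + 2 * h) + 3 * \<phi> (t + h) - \<phi> t = 0"
proof -
  let ?X = "{k\<in>{1..N}. c k \<noteq> 0} - {k0}"
  have "card ?X \<le> 3" using four k0 by (simp add: card_Diff_singleton)
  then obtain k1 k2 k3 where k: "?X \<subseteq> {k1, k2, k3}" "k1 \<noteq> k0" "k2 \<noteq> k0" "k3 \<noteq> k0"
                               "k1 \<le> N + 1" "k2 \<le> N + 1" "k3 \<le> N + 1"
  proof -
    obtain xs where xs: "set xs = ?X" "distinct xs"
      using finite_distinct_list[of ?X] by auto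
    then have "length xs \<le> 3" using \<open>card ?X \<le> 3\<close> distinct_card by metis
    \<comment> \<open>The index \<open>N + 1\<close> fills up the list when there are fewer than three other terms.\<close>
    define ys where "ys = xs @ [N + 1, N + 1, N + 1]"
    have ys: "ys ! i \<in> ?X \<union> {N + 1}" if "i < 3" for i
    proof -
      have "ys ! i \<in> set ys" using that by (intro nth_mem) (simp add: ys_def)
      then show ?thesis using xs by (auto simp: ys_def)
    qed
    have "?X \<subseteq> {ys ! 0, ys ! 1, ys ! 2}"
    proof
      fix k assume "k \<in> ?X"
      then obtain i where "i < length xs" "xs ! i = k" using xs by (metis in_set_conv_nth)
      then have "i < 3" "ys ! i = k" using \<open>length xs \<le> 3\<close> by (auto simp: ys_def nth_append)
      then show "k \<in> {ys ! 0, ys ! 1, ys ! 2}"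
        by (auto simp: numeral_3_eq_3 less_Suc_eq numeral_2_eq_2)
    qed
    moreover have "ys ! i \<noteq> k0 \<and> ys ! i \<le> N + 1" if "i < 3" for i
      using ys[OF that] k0 by auto
    ultimately show thesis using that[of "ys ! 0" "ys ! 1" "ys ! 2"] by auto
  qed
  define \<delta> where "\<delta> = r / (3 * real N + 7)"
  have "\<delta> > 0" using \<open>0 < r\<close> by (simp add: \<delta>_def add_nonneg_pos)
  have \<delta>r: "\<delta> * (3 * real N + 7) = r"
  proof -
    have "3 * real N + 7 \<noteq> 0" by linarith
    then show ?thesis unfolding \<delta>_def by simp
  qed
  have "\<phi> (t + 3 * h) - 3 * \<phi> (t + 2 * h) + 3 * \<phi> (t + h) - \<phi> t = 0"
    if t: "\<bar>t - (x0 + real k0 * y0)\<bar> < \<delta>" and h: "\<bar>h\<bar> < \<delta>" for t h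
  proof -
    define s where "s k = h / (real k0 - real k)" for k
    have s: "(real k0 - real k) * s k = h" if "k \<noteq> k0" for k
      using that by (simp add: s_def)
    have s_le: "\<bar>s k\<bar> \<le> \<bar>h\<bar>" if "k \<noteq> k0" for k
    proof -
      have "\<bar>real k0 - real k\<bar> \<ge> 1" using that by linarith
      then show ?thesis unfolding s_def abs_divide
        by (simp add: divide_le_eq mult_le_cancel_left1)
    qed
    have ks_le: "\<bar>real k * s k\<bar> \<le> (real N + 1) * \<bar>h\<bar>" if "k \<noteq> k0" "k \<le> N + 1" for k
      unfolding abs_mult using s_le[OF that(1)] that(2) by (intro mult_mono) auto
    define x where "x = t - real k0 * y0"
    \<comment> \<open>\<open>a1, a2, a3\<close> are 0 or 1 and tell which of the three moves are carried out.\<close>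
    define G where "G a1 a2 a3 k = \<phi> (x + real k * y0 + a1 * ((real k - real k1) * s k1)
        + a2 * ((real k - real k2) * s k2) + a3 * ((real k - real k3) * s k3))" for a1 a2 a3 :: real and k
    have G: "(\<Sum>k\<in>{1..N}. c k * G a1 a2 a3 k) = d" if "a1 \<in> {0,1}" "a2 \<in> {0,1}" "a3 \<in> {0,1}" for a1 a2 a3
    proof -
      define x' where "x' = x - a1 * (real k1 * s k1) - a2 * (real k2 * s k2) - a3 * (real k3 * s k3)"
      define y' where "y' = y0 + a1 * s k1 + a2 * s k2 + a3 * s k3"
      have a: "\<bar>a1 * z\<bar> \<le> \<bar>z\<bar>" "\<bar>a2 * z\<bar> \<le> \<bar>z\<bar>" "\<bar>a3 * z\<bar> \<le> \<bar>z\<bar>" for z using that by auto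
      have "\<bar>y' - y0\<bar> \<le> 3 * \<bar>h\<bar>"
        using order_trans[OF a(1) s_le[OF k(2)]] order_trans[OF a(2) s_le[OF k(3)]]
          order_trans[OF a(3) s_le[OF k(4)]]
          abs_triangle_ineq[of "a1 * s k1 + a2 * s k2" "a3 * s k3"] abs_triangle_ineq[of "a1 * s k1" "a2 * s k2"]
        unfolding y'_def by (simp add: algebra_simps)
      also have "\<dots> < 3 * \<delta>" using h by simp
      also have "\<dots> \<le> r" using \<delta>r \<open>\<delta> > 0\<close> by (auto simp: algebra_simps)
      finally have y': "\<bar>y' - y0\<bar> < r" .
      have "\<bar>x' - x0\<bar> \<le> \<bar>x - x0\<bar> + 3 * ((real N + 1) * \<bar>h\<bar>)"
      proof -
        let ?p = "a1 * (real k1 * s k1)" and ?q = "a2 * (real k2 * s k2)" and ?r = "a3 * (real k3 * s k3)"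
        have "\<bar>x' - x0\<bar> \<le> \<bar>x - x0\<bar> + (\<bar>?p\<bar> + \<bar>?q\<bar> + \<bar>?r\<bar>)"
          unfolding x'_def by linarith
        then show ?thesis
          using order_trans[OF a(1) ks_le[OF k(2,5)]] order_trans[OF a(2) ks_le[OF k(3,6)]]
            order_trans[OF a(3) ks_le[OF k(4,7)]]
          by argo
      qed
      also have "\<dots> < \<delta> + 3 * ((real N + 1) * \<delta>)"
      proof -
        have "(real N + 1) * \<bar>h\<bar> \<le> (real N + 1) * \<delta>" using h by (intro mult_left_mono) auto
        moreover have "\<bar>x - x0\<bar> < \<delta>" using t unfolding x_def by (simp add: algebra_simps)
        ultimately show ?thesis by linarith
      qed
      also have "\<dots> \<le> r" using \<delta>r \<open>\<delta> > 0\<close> by (auto simp: algebra_simps)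
      finally have x': "\<bar>x' - x0\<bar> < r" .
      have "combination \<phi> N c x' y' = d" using box x' y' unfolding box_related_def by blast
      moreover have "\<phi> (x' + real k * y') = G a1 a2 a3 k" for k
        unfolding G_def x'_def y'_def by (rule arg_cong[of _ _ \<phi>]) (simp add: algebra_simps)
      ultimately show ?thesis unfolding combination_def by simp
    qed
    \<comment> \<open>\<open>H k\<close> is an iterated difference that vanishes for \<open>k = k1, k2, k3\<close>.\<close>
    define H where "H k = G 1 1 1 k - G 1 1 0 k - G 1 0 1 k - G 0 1 1 k + G 1 0 0 k + G 0 1 0 k + G 0 0 1 k - G 0 0 0 k" for k
    have "(\<Sum>k\<in>{1..N}. c k * H k) = 0"
      unfolding H_def right_diff_distrib distrib_left sum.distrib sum_subtractf by (simp add: G del: One_nat_def)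
    moreover have "(\<Sum>k\<in>{1..N}. c k * H k) = c k0 * H k0"
    proof -
      have "c k * H k = 0" if "k \<in> {1..N} - {k0}" for k
      proof (cases "c k = 0")
        case False
        with that k(1) have "k = k1 \<or> k = k2 \<or> k = k3" by blast
        then have "H k = 0" by (elim disjE) (simp_all add: H_def G_def)
        then show ?thesis by simp
      qed simp
      then have "(\<Sum>k\<in>{1..N} - {k0}. c k * H k) = 0" by (intro sum.neutral) blast
      then show ?thesis using sum.remove[of "{1..N}" k0 "\<lambda>k. c k * H k"] k0 by simp
    qed
    ultimately have "H k0 = 0" using k0 by simp
    moreover have "G a1 a2 a3 k0 = \<phi> (t + (a1 + a2 + a3) * h)" for a1 a2 a3
      unfolding G_def s[OF k(2)] s[OF k(3)] s[OF k(4)] x_def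
      by (rule arg_cong[of _ _ \<phi>]) (simp add: algebra_simps)
    ultimately show ?thesis unfolding H_def by simp
  qed
  then show ?thesis using \<open>\<delta> > 0\<close> by blast
qed

section \<open>Progressions cannot all satisfy one of finitely many relations\<close>

text \<open>
  The situation to be refuted when \<open>\<phi>\<close> has a non-null set of nonlinearity: every progression
  satisfies one of finitely many relations. The condition on the moments says that no relation
  holds identically for a quadratic polynomial with nonzero leading coefficient; affine functions
  may well satisfy a relation identically. The bound on the number of terms is what makes third
  differences sufficient.
\<close>
locale everywhere_related =
  fixes \<phi> :: "real \<Rightarrow> real" and N :: nat and C :: "((nat \<Rightarrow> real) \<times> real) set"
  assumes cont: "continuous_on UNIV \<phi>"
    and fin: "finite C"
    and related: "y \<noteq> 0 \<Longrightarrow> \<exists>(c, d)\<in>C. combination \<phi> N c x y = d"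
    and four: "(c, d) \<in> C \<Longrightarrow> card {k\<in>{1..N}. c k \<noteq> 0} \<le> 4"
    and moments: "(c, d) \<in> C \<Longrightarrow> \<exists>j\<le>2. (\<Sum>k\<in>{1..N}. c k * real k ^ j) \<noteq> 0"
begin

abbreviation "E \<equiv> nonlinearity_set \<phi>"

lemma relation_on_box:
  assumes "open W" "W \<noteq> {}" "\<And>p. p \<in> W \<Longrightarrow> snd p \<noteq> 0"
  shows "\<exists>c d x0 y0 r. (c, d) \<in> C \<and> 0 < r \<and> box_related \<phi> N c d x0 y0 r \<and>
     (\<forall>x y. \<bar>x - x0\<bar> < r \<longrightarrow> \<bar>y - y0\<bar> < r \<longrightarrow> (x, y) \<in> W)"
proof -
  define F where "F = (\<lambda>(c, d). {p. combination \<phi> N c (fst p) (snd p) = d}) ` C"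
  have "continuous_on UNIV (\<lambda>p::real \<times> real. \<phi> (fst p + real k * snd p))" for k
    by (rule continuous_on_compose2[OF cont]) (auto intro!: continuous_intros)
  then have cl: "closed {p. combination \<phi> N c (fst p) (snd p) = d}" for c d
    unfolding combination_def by (intro closed_Collect_eq continuous_intros)
  have "\<exists>S\<in>F. \<exists>p r. 0 < r \<and> ball p r \<subseteq> S \<inter> W"
  proof (rule finite_closed_cover_contains_ball)
    show "W \<subseteq> \<Union>F"
    proof
      fix p assume "p \<in> W"
      then obtain c d where "(c, d) \<in> C" "combination \<phi> N c (fst p) (snd p) = d"
        using related[of "snd p" "fst p"] assms(3) by blast
      then show "p \<in> \<Union>F" unfolding F_def by blast
    qed
  qed (use fin cl assms in \<open>auto simp: F_def\<close>)
  then obtain c d p r where cd: "(c, d) \<in> C" "0 < r"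
    "ball p r \<subseteq> {p. combination \<phi> N c (fst p) (snd p) = d} \<inter> W"
    unfolding F_def by (auto simp: split_def)
  have "(x, y) \<in> ball p r" if "\<bar>x - fst p\<bar> < r / 2" "\<bar>y - snd p\<bar> < r / 2" for x y
  proof -
    have "dist p (x, y) = sqrt ((fst p - x)\<^sup>2 + (snd p - y)\<^sup>2)"
      by (simp add: dist_prod_def dist_real_def)
    also have "\<dots> \<le> \<bar>fst p - x\<bar> + \<bar>snd p - y\<bar>" by (rule sqrt_sum_squares_le_sum_abs)
    finally show ?thesis using that unfolding mem_ball by argo
  qed
  then have "combination \<phi> N c x y = d \<and> (x, y) \<in> W"
    if "\<bar>x - fst p\<bar> < r / 2" "\<bar>y - snd p\<bar> < r / 2" for x y
    using cd(3) that by (metis (mono_tags, lifting) IntD1 IntD2 fst_conv mem_Collect_eq snd_conv subsetD)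
  then show ?thesis
    using cd unfolding box_related_def
    by (intro exI[of _ c] exI[of _ d] exI[of _ "fst p"] exI[of _ "snd p"] exI[of _ "r / 2"]) auto
qed

text \<open>
  Progressions with small common difference near a point of \<open>J\<close> provide the open set of
  parameters.
\<close>
lemma relation_on_progressions_in:
  assumes "open J" "J \<noteq> {}"
  shows "\<exists>c d x0 y0 r. (c, d) \<in> C \<and> 0 < r \<and> box_related \<phi> N c d x0 y0 r \<and>
     (\<forall>x y. \<bar>x - x0\<bar> < r \<longrightarrow> \<bar>y - y0\<bar> < r \<longrightarrow> (\<forall>k\<in>{1..N}. x + real k * y \<in> J))"
proof -
  define W where "W = {p. snd p \<noteq> 0} \<inter> (\<Inter>k\<in>{1..N}. (\<lambda>p. fst p + real k * snd p) -` J)"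
  have "open W"
    unfolding W_def using \<open>open J\<close>
    by (intro open_Int open_INT ballI open_vimage open_Collect_neq continuous_intros) auto
  obtain z \<rho> where z: "0 < \<rho>" "ball z \<rho> \<subseteq> J" using assms openE by blast
  have "(z, \<rho> / (real N + 1)) \<in> W"
  proof -
    have "real k * (\<rho> / (real N + 1)) < \<rho>" if "k \<in> {1..N}" for k
    proof -
      have "real k * \<rho> < (real N + 1) * \<rho>" using that z(1) by (intro mult_strict_right_mono) auto
      then show ?thesis by (simp add: field_simps)
    qed
    then have "z + real k * (\<rho> / (real N + 1)) \<in> ball z \<rho>" if "k \<in> {1..N}" for k
      using that z(1) by (simp add: dist_real_def)
    then show ?thesis unfolding W_def using z by auto
  qed
  then obtain c d x0 y0 r where "(c, d) \<in> C" "0 < r" "box_related \<phi> N c d x0 y0 r"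
    and W: "\<And>x y. \<bar>x - x0\<bar> < r \<Longrightarrow> \<bar>y - y0\<bar> < r \<Longrightarrow> (x, y) \<in> W"
    using relation_on_box[OF \<open>open W\<close>] unfolding W_def by blast
  moreover have "x + real k * y \<in> J" if "\<bar>x - x0\<bar> < r" "\<bar>y - y0\<bar> < r" "k \<in> {1..N}" for x y k
    using W[OF that(1,2)] that(3) unfolding W_def by auto
  ultimately show ?thesis by blast
qed

text \<open>
  The coefficients of \<open>x\<^sup>2\<close>, \<open>x * y\<close> and \<open>y\<^sup>2\<close> in a relation for a
  quadratic polynomial are \<open>A\<close> times the moments of order 0, 1, 2, up to a factor 2.
\<close>
lemma no_quadratic_piece:
  assumes "open J" "J \<noteq> {}" and q: "\<And>t. t \<in> J \<Longrightarrow> \<phi> t = A * t\<^sup>2 + B * t + D"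
  shows "A = 0"
proof (rule ccontr)
  assume "A \<noteq> 0"
  obtain c d x0 y0 r where c: "(c, d) \<in> C" "0 < r" "box_related \<phi> N c d x0 y0 r"
    and J: "\<And>x y k. \<bar>x - x0\<bar> < r \<Longrightarrow> \<bar>y - y0\<bar> < r \<Longrightarrow> k \<in> {1..N} \<Longrightarrow> x + real k * y \<in> J"
    using relation_on_progressions_in[OF assms(1,2)] by blast
  define m where "m j = (\<Sum>k\<in>{1..N}. c k * real k ^ j)" for j
  have "A * m 0 * x\<^sup>2 + 2 * A * m 1 * x * y + A * m 2 * y\<^sup>2 + B * m 0 * x + B * m 1 * y + (D * m 0 - d) = 0"
    if "\<bar>x - x0\<bar> < r" "\<bar>y - y0\<bar> < r" for x y
  proof -
    have "d = combination \<phi> N c x y" using c(3) that unfolding box_related_def by simp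
    also have "\<dots> = (\<Sum>k\<in>{1..N}. c k * (A * (x + real k * y)\<^sup>2 + B * (x + real k * y) + D))"
      unfolding combination_def using q J[OF that] by (intro sum.cong) auto
    also have "\<dots> = (\<Sum>k\<in>{1..N}. (A * x\<^sup>2 + B * x + D) * (c k * real k ^ 0) + (2 * A * x * y + B * y) * (c k * real k ^ 1)
        + A * y\<^sup>2 * (c k * real k ^ 2))"
      by (intro sum.cong) (simp_all add: power2_eq_square algebra_simps)
    also have "\<dots> = (A * x\<^sup>2 + B * x + D) * m 0 + (2 * A * x * y + B * y) * m 1 + A * y\<^sup>2 * m 2"
      unfolding m_def sum.distrib sum_distrib_left ..
    finally show ?thesis by algebra
  qed
  from quadratic_in_two_variables_zero[OF \<open>0 < r\<close> this]
  have "m 0 = 0 \<and> m 1 = 0 \<and> m 2 = 0" using \<open>A \<noteq> 0\<close> by auto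
  moreover obtain j where "j \<le> 2" "m j \<noteq> 0" using moments[OF c(1)] unfolding m_def by blast
  moreover from \<open>j \<le> 2\<close> have "j = 0 \<or> j = 1 \<or> j = 2" by auto
  ultimately show False by auto
qed

text \<open>
  On an interval inside \<open>E\<close> some relation would hold on a box of parameters. Then \<open>\<phi>\<close>
  would be quadratic on a smaller interval, with leading coefficient 0 because of the moments, hence
  affine there.
\<close>
lemma interior_nonlinearity_set: "interior E = {}"
proof (rule ccontr)
  assume "interior E \<noteq> {}"
  then obtain c d x0 y0 r where c: "(c, d) \<in> C" "0 < r" "box_related \<phi> N c d x0 y0 r"
    and J: "\<And>x y k. \<bar>x - x0\<bar> < r \<Longrightarrow> \<bar>y - y0\<bar> < r \<Longrightarrow> k \<in> {1..N} \<Longrightarrow> x + real k * y \<in> interior E"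
    using relation_on_progressions_in[OF open_interior[of E]] by blast
  have "\<exists>k0\<in>{1..N}. c k0 \<noteq> 0"
    using moments[OF c(1)] by (metis (mono_tags, lifting) mult_eq_0_iff sum.neutral)
  then obtain k0 where k0: "k0 \<in> {1..N}" "c k0 \<noteq> 0" by blast
  define t0 where "t0 = x0 + real k0 * y0"
  obtain \<delta> where "\<delta> > 0" and \<delta>: "\<And>t h. \<bar>t - t0\<bar> < \<delta> \<Longrightarrow> \<bar>h\<bar> < \<delta> \<Longrightarrow>
      \<phi> (t + 3 * h) - 3 * \<phi> (t + 2 * h) + 3 * \<phi> (t + h) - \<phi> t = 0"
    using third_differences_zero[OF c(3,2) k0 four[OF c(1)]] unfolding t0_def by blast
  define \<eta> where "\<eta> = \<delta> / 4"
  have "\<eta> > 0" using \<open>\<delta> > 0\<close> by (simp add: \<eta>_def)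
  obtain A B D where q: "\<And>t. t0 \<le> t \<Longrightarrow> t \<le> t0 + \<eta> \<Longrightarrow> \<phi> t = A * t\<^sup>2 + B * t + D"
    by (rule quadratic_if_third_differences_zero[OF cont \<open>\<eta> > 0\<close>, of t0])
      (use \<delta> in \<open>auto simp: \<eta>_def\<close>)
  define J' where "J' = interior E \<inter> {t0<..<t0 + \<eta>}"
  have "t0 \<in> interior E" using J[of x0 y0 k0] c(2) k0 by (simp add: t0_def)
  then obtain \<rho> where "\<rho> > 0" "ball t0 \<rho> \<subseteq> interior E" using openE[OF open_interior] by blast
  then have "t0 + min \<rho> \<eta> / 2 \<in> J'"
    using \<open>\<eta> > 0\<close> unfolding J'_def by (auto simp: subset_eq dist_real_def)
  moreover have "open J'" unfolding J'_def by auto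
  moreover have qJ: "\<phi> t = A * t\<^sup>2 + B * t + D" if "t \<in> J'" for t using that q unfolding J'_def by auto
  ultimately have "A = 0" by (intro no_quadratic_piece[of J' A B D]) auto
  then have "t \<notin> E" if "t \<in> J'" for t
    using \<open>open J'\<close> qJ that unfolding nonlinearity_set_def point_of_nonlinearity_def by auto
  with \<open>t0 + min \<rho> \<eta> / 2 \<in> J'\<close> show False unfolding J'_def using interior_subset by blast
qed

end

section \<open>Moving the terms of a progression off the set of nonlinearity\<close>
lemma abs_progression_shift_less:
  fixes x y x' y' r :: real
  assumes "\<bar>x' - x\<bar> < r" "\<bar>y' - y\<bar> < r" "k \<le> N"
  shows "\<bar>x' + real k * y' - (x + real k * y)\<bar> < (real N + 1) * r"
proof -
  have "\<bar>x' + real k * y' - (x + real k * y)\<bar> = \<bar>(x' - x) + real k * (y' - y)\<bar>"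
    by (simp add: algebra_simps)
  also have "\<dots> \<le> \<bar>x' - x\<bar> + real k * \<bar>y' - y\<bar>"
    using abs_triangle_ineq[of "x' - x" "real k * (y' - y)"] by (simp add: abs_mult)
  also have "\<dots> < r + real N * r"
    using assms by (intro add_less_le_mono mult_mono) auto
  finally show ?thesis by (simp add: algebra_simps)
qed

lemma affine_near_progression_terms:
  assumes "\<And>k. k \<in> T \<Longrightarrow> x + real k * y \<notin> nonlinearity_set \<phi>" "T \<subseteq> {1..N}"
  shows "\<exists>\<alpha> \<beta> r. 0 < r \<and> (\<forall>k\<in>T. \<forall>x' y'. \<bar>x' - x\<bar> < r \<longrightarrow> \<bar>y' - y\<bar> < r \<longrightarrow>
     \<phi> (x' + real k * y') = \<alpha> k * (x' + real k * y') + \<beta> k \<and> x' + real k * y' \<notin> nonlinearity_set \<phi>)"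
proof -
  have "finite T" using assms(2) finite_subset by blast
  have "\<forall>k\<in>T. \<exists>\<alpha> \<beta> r. 0 < r \<and> (\<forall>u. \<bar>u - (x + real k * y)\<bar> < r \<longrightarrow> \<phi> u = \<alpha> * u + \<beta>)"
    using assms(1) unfolding not_in_nonlinearity_set_iff by blast
  then obtain \<alpha> \<beta> \<rho> where \<rho>: "\<And>k. k \<in> T \<Longrightarrow> 0 < \<rho> k"
    and aff: "\<And>k u. k \<in> T \<Longrightarrow> \<bar>u - (x + real k * y)\<bar> < \<rho> k \<Longrightarrow> \<phi> u = \<alpha> k * u + \<beta> k"
    by metis
  define r where "r = Min (insert 1 (\<rho> ` T)) / (real N + 1)"
  have "0 < Min (insert 1 (\<rho> ` T))" using \<rho> \<open>finite T\<close> by (auto simp: Min_gr_iff)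
  then have "0 < r" unfolding r_def by simp
  have near: "\<bar>x' + real k * y' - (x + real k * y)\<bar> < \<rho> k"
    if "k \<in> T" "\<bar>x' - x\<bar> < r" "\<bar>y' - y\<bar> < r" for k x' y'
  proof -
    have "\<bar>x' + real k * y' - (x + real k * y)\<bar> < (real N + 1) * r"
      using that assms(2) by (intro abs_progression_shift_less) auto
    also have "\<dots> = Min (insert 1 (\<rho> ` T))" unfolding r_def by simp
    also have "\<dots> \<le> \<rho> k" using \<open>k \<in> T\<close> \<open>finite T\<close> by simp
    finally show ?thesis .
  qed
  have "v \<notin> nonlinearity_set \<phi>" if "k \<in> T" "\<bar>v - (x + real k * y)\<bar> < \<rho> k" for k v
    unfolding not_in_nonlinearity_set_iff
  proof (intro exI conjI allI impI)
    show "0 < \<rho> k - \<bar>v - (x + real k * y)\<bar>" using that by simp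
    fix u assume "\<bar>u - v\<bar> < \<rho> k - \<bar>v - (x + real k * y)\<bar>"
    then have "\<bar>u - (x + real k * y)\<bar> < \<rho> k" by linarith
    then show "\<phi> u = \<alpha> k * u + \<beta> k" using aff that by blast
  qed
  then have "\<phi> (x' + real k * y') = \<alpha> k * (x' + real k * y') + \<beta> k \<and> x' + real k * y' \<notin> nonlinearity_set \<phi>"
    if "k \<in> T" "\<bar>x' - x\<bar> < r" "\<bar>y' - y\<bar> < r" for k x' y'
    using near[OF that] aff \<open>k \<in> T\<close> by simp
  then show ?thesis using \<open>0 < r\<close> by (intro exI[of _ \<alpha>] exI[of _ \<beta>] exI[of _ r]) simp
qed

text \<open>
  Where all terms with nonzero coefficient are affine, the combination is an affine function of
  \<open>(x, y)\<close>.
\<close>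
lemma box_related_extends:
  assumes aff: "\<And>k x' y'. k \<in> {1..N} - S \<Longrightarrow> \<bar>x' - x\<bar> < r \<Longrightarrow> \<bar>y' - y\<bar> < r \<Longrightarrow>
        \<phi> (x' + real k * y') = \<alpha> k * (x' + real k * y') + \<beta> k"
    and c: "\<And>k. k \<in> S \<Longrightarrow> c k = 0"
    and box: "box_related \<phi> N c d x1 y1 r1" "0 < r1"
    and "\<bar>x1 - x\<bar> < r" "\<bar>y1 - y\<bar> < r"
  shows "box_related \<phi> N c d x y r"
proof -
  define P where "P = (\<Sum>k\<in>{1..N} - S. c k * \<alpha> k)"
  define Q where "Q = (\<Sum>k\<in>{1..N} - S. c k * \<alpha> k * real k)"
  define R where "R = (\<Sum>k\<in>{1..N} - S. c k * \<beta> k)"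
  have comb: "combination \<phi> N c x' y' = P * x' + Q * y' + R"
    if "\<bar>x' - x\<bar> < r" "\<bar>y' - y\<bar> < r" for x' y'
  proof -
    have "combination \<phi> N c x' y' = (\<Sum>k\<in>{1..N} - S. c k * \<phi> (x' + real k * y'))"
      unfolding combination_def using c by (intro sum.mono_neutral_right) auto
    also have "\<dots> = (\<Sum>k\<in>{1..N} - S. (c k * \<alpha> k) * x' + (c k * \<alpha> k * real k) * y' + c k * \<beta> k)"
      using aff that by (intro sum.cong) (auto simp: algebra_simps)
    also have "\<dots> = P * x' + Q * y' + R"
      unfolding P_def Q_def R_def sum.distrib sum_distrib_right ..
    finally show ?thesis .
  qed
  define r2 where "r2 = min r1 (min (r - \<bar>x1 - x\<bar>) (r - \<bar>y1 - y\<bar>))"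
  have r2: "0 < r2" "r2 \<le> r1" "r2 \<le> r - \<bar>x1 - x\<bar>" "r2 \<le> r - \<bar>y1 - y\<bar>"
    using assms(4-6) by (auto simp: r2_def)
  have "0 * x'\<^sup>2 + 0 * x' * y' + 0 * y'\<^sup>2 + P * x' + Q * y' + (R - d) = 0"
    if "\<bar>x' - x1\<bar> < r2" "\<bar>y' - y1\<bar> < r2" for x' y'
  proof -
    have "combination \<phi> N c x' y' = d" using box(1) that r2 unfolding box_related_def by auto
    moreover have "\<bar>x' - x\<bar> < r" "\<bar>y' - y\<bar> < r" using that r2 by linarith+
    ultimately show ?thesis using comb by simp
  qed
  from quadratic_in_two_variables_zero[OF r2(1) this] have "P = 0" "Q = 0" "R = d" by auto
  then show ?thesis unfolding box_related_def using comb by simp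
qed

text \<open>
  All terms of the relation except the one with number \<open>b\<close> are affine near \<open>(x, y)\<close>. Keeping
  \<open>u\<close> fixed and varying the common difference shows that the relation does not depend on the
  common difference. So the value at \<open>u\<close> is given by an affine function that is
  determined by the relation and the affine pieces alone, whatever progression through \<open>u\<close> was
  used.
\<close>
lemma value_determined_by_affine_terms:
  assumes b: "b \<in> {1..N}" "b \<notin> S" "c b \<noteq> 0"
    and c: "\<And>k. k \<in> S \<Longrightarrow> c k = 0"
    and T: "T = {1..N} - insert b S"
    and aff: "\<And>k x' y'. k \<in> T \<Longrightarrow> \<bar>x' - x\<bar> < r \<Longrightarrow> \<bar>y' - y\<bar> < r \<Longrightarrow>
        \<phi> (x' + real k * y') = \<alpha> k * (x' + real k * y') + \<beta> k"
    and box: "box_related \<phi> N c d x1 y1 r1" "0 < r1"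
    and near: "\<bar>x1 - x\<bar> < r" "\<bar>y1 - y\<bar> < r"
    and u: "u = x1 + real b * y1"
  shows "\<phi> u = (- (\<Sum>k\<in>T. c k * \<alpha> k) / c b) * u + (d - (\<Sum>k\<in>T. c k * \<beta> k)) / c b"
proof -
  define P where "P = (\<Sum>k\<in>T. c k * \<alpha> k)"
  define Q where "Q = (\<Sum>k\<in>T. c k * \<alpha> k * (real k - real b))"
  define R where "R = (\<Sum>k\<in>T. c k * \<beta> k)"
  define m where "m = min r1 (min (r - \<bar>x1 - x\<bar>) (r - \<bar>y1 - y\<bar>))"
  have m: "0 < m" "m \<le> r1" "m \<le> r - \<bar>x1 - x\<bar>" "m \<le> r - \<bar>y1 - y\<bar>"
    using box(2) near by (auto simp: m_def)
  have eq: "c b * \<phi> u + P * u + Q * (y1 + h) + R = d" if h: "0 \<le> h" "(real b + 1) * h < m" for h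
  proof -
    define x' where "x' = u - real b * (y1 + h)"
    have bh: "0 \<le> real b * h" "real b * h + h < m" using h by (auto simp: algebra_simps)
    have "x' = x1 - real b * h" unfolding x'_def u by (simp add: algebra_simps)
    then have x': "\<bar>x' - x1\<bar> < m" using bh h(1) by linarith
    have y': "\<bar>(y1 + h) - y1\<bar> < m" using bh h(1) by linarith
    have "\<bar>x' - x1\<bar> < r1" "\<bar>(y1 + h) - y1\<bar> < r1" using x' y' m by linarith+
    then have "d = combination \<phi> N c x' (y1 + h)" using box(1) unfolding box_related_def by simp
    also have "\<dots> = (\<Sum>k\<in>insert b T. c k * \<phi> (x' + real k * (y1 + h)))"
      unfolding combination_def T using c b by (intro sum.mono_neutral_right) auto
    also have "\<dots> = c b * \<phi> (x' + real b * (y1 + h)) + (\<Sum>k\<in>T. c k * \<phi> (x' + real k * (y1 + h)))"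
      unfolding T by (rule sum.insert) auto
    also have "x' + real b * (y1 + h) = u" by (simp add: x'_def)
    also have "(\<Sum>k\<in>T. c k * \<phi> (x' + real k * (y1 + h))) =
        (\<Sum>k\<in>T. (c k * \<alpha> k) * u + (c k * \<alpha> k * (real k - real b)) * (y1 + h) + c k * \<beta> k)"
    proof (intro sum.cong refl)
      fix k assume "k \<in> T"
      moreover have "\<bar>x' - x\<bar> < r" "\<bar>(y1 + h) - y\<bar> < r" using x' y' m by linarith+
      ultimately have eq: "\<phi> (x' + real k * (y1 + h)) = \<alpha> k * (x' + real k * (y1 + h)) + \<beta> k"
        using aff by blast
      then show "c k * \<phi> (x' + real k * (y1 + h)) =
          (c k * \<alpha> k) * u + (c k * \<alpha> k * (real k - real b)) * (y1 + h) + c k * \<beta> k"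
        unfolding eq by (simp add: x'_def algebra_simps)
    qed
    also have "\<dots> = P * u + Q * (y1 + h) + R"
      unfolding P_def Q_def R_def sum.distrib sum_distrib_right ..
    finally show ?thesis by simp
  qed
  define h where "h = m / (real b + 2)"
  have h: "0 < h" using m(1) by (simp add: h_def)
  have "(real b + 2) * h = m" unfolding h_def by simp
  then have "(real b + 1) * h < m" using h by (simp add: algebra_simps)
  then have "c b * \<phi> u + P * u + Q * (y1 + h) + R = d" using eq[of h] h by simp
  moreover have *: "c b * \<phi> u + P * u + Q * y1 + R = d" using eq[of 0] m(1) by simp
  ultimately have "Q * (y1 + h) = Q * y1" by linarith
  then have "Q * h = 0" by (simp add: distrib_left)
  with h have "Q = 0" by simp
  with * have "c b * \<phi> u = - P * u + (d - R)" by simp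
  then have "\<phi> u = (- P * u + (d - R)) / c b" using b(3) by (simp add: eq_divide_eq mult.commute)
  then show ?thesis unfolding P_def R_def by (simp add: add_divide_distrib diff_divide_distrib)
qed

text \<open>
  If the nonlinearity set has empty interior, its complement is dense, and the union of the
  finitely many lines is closed.
\<close>
lemma finite_nonlinearity_set_if_linear_part_in_lines:
  assumes cont: "continuous_on UNIV \<phi>" and "open I" "finite L" "interior (nonlinearity_set \<phi>) = {}"
    and lines: "\<And>u. u \<in> I \<Longrightarrow> u \<notin> nonlinearity_set \<phi> \<Longrightarrow> \<exists>(\<alpha>, \<beta>)\<in>L. \<phi> u = \<alpha> * u + \<beta>"
  shows "finite (nonlinearity_set \<phi> \<inter> I)"
proof (rule finite_nonlinearity_set_if_graph_in_lines[OF cont \<open>open I\<close> \<open>finite L\<close>])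
  define G where "G = (\<Union>p\<in>L. {u. \<phi> u = fst p * u + snd p})"
  have "closed {u. \<phi> u = fst p * u + snd p}" for p
    by (intro closed_Collect_eq continuous_intros cont)
  then have "closed G" unfolding G_def using \<open>finite L\<close> by (intro closed_UN) auto
  then have "open (I - G)" using \<open>open I\<close> by (intro open_Diff) auto
  moreover have "I - G \<subseteq> nonlinearity_set \<phi>" using lines unfolding G_def by force
  ultimately have "I - G \<subseteq> interior (nonlinearity_set \<phi>)" by (rule interior_maximal[rotated])
  then have "I \<subseteq> G" using assms(4) by blast
  then show "\<exists>(\<alpha>, \<beta>)\<in>L. \<phi> u = \<alpha> * u + \<beta>" if "u \<in> I" for u
    using that unfolding G_def by force
qed

context everywhere_related
begin

text \<open>
  The heart of the proof, by induction on the set \<open>S\<close> of terms that are density points of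
  \<open>E\<close>. If \<open>S\<close> is empty, \<open>\<phi>\<close> is affine near all terms and one of the relations
  must hold on an open set, hence near the given progression. In the step, move the term number
  \<open>b\<close> to an arbitrary nearby \<open>u\<close> on the right and outside \<open>E\<close>, keeping the terms from
  \<open>S\<close> density points. The induction hypothesis gives a relation that involves, apart from
  \<open>b\<close>, only terms at which \<open>\<phi>\<close> is affine already. If it does not involve \<open>b\<close>, it
  extends to the original progression. Otherwise it puts the graph of \<open>\<phi>\<close> at \<open>u\<close> on one of
  finitely many lines. If this happened for all \<open>u\<close>, then \<open>E\<close> would have finitely many
  points just to the right of one of its density points.
\<close>
lemma relation_among_affine_terms:
  assumes "S \<subseteq> {1..N}" "y \<noteq> 0"
    and "\<And>k. k \<in> S \<Longrightarrow> x + real k * y \<in> right_density_points E"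
    and "\<And>k. k \<in> {1..N} - S \<Longrightarrow> x + real k * y \<notin> E"
  shows "\<exists>c d r. (c, d) \<in> C \<and> (\<forall>k\<in>S. c k = 0) \<and> 0 < r \<and> box_related \<phi> N c d x y r"
proof -
  have "finite S" using assms(1) finite_subset by blast
  then show ?thesis using assms
  proof (induction S arbitrary: x y rule: finite_induct)
    case empty
    obtain \<alpha> \<beta> r where r: "0 < r" and aff: "\<And>k x' y'. k \<in> {1..N} - {} \<Longrightarrow> \<bar>x' - x\<bar> < r \<Longrightarrow> \<bar>y' - y\<bar> < r \<Longrightarrow>
        \<phi> (x' + real k * y') = \<alpha> k * (x' + real k * y') + \<beta> k"
      using affine_near_progression_terms[of "{1..N} - {}" x y \<phi> N] empty.prems(4) by blast
    define W where "W = {p. \<bar>fst p - x\<bar> < r} \<inter> {p. \<bar>snd p - y\<bar> < r} \<inter> {p. snd p \<noteq> 0}"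
    have "open W" unfolding W_def
      by (intro open_Int open_Collect_less open_Collect_neq continuous_intros)
    moreover have "(x, y) \<in> W" using r empty.prems(2) by (simp add: W_def)
    ultimately obtain c d x1 y1 r1 where c: "(c, d) \<in> C" "0 < r1" "box_related \<phi> N c d x1 y1 r1"
      and W: "\<And>x y. \<bar>x - x1\<bar> < r1 \<Longrightarrow> \<bar>y - y1\<bar> < r1 \<Longrightarrow> (x, y) \<in> W"
      using relation_on_box[of W] unfolding W_def by blast
    have "(x1, y1) \<in> W" using W c(2) by simp
    then have "box_related \<phi> N c d x y r"
      by (intro box_related_extends[OF aff _ c(3,2)]) (auto simp: W_def)
    then show ?case using c(1) r by blast
  next
    case (insert b S)
    define e where "e = x + real b * y"
    have b: "b \<in> {1..N}" using insert.prems(1) by simp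
    then have "0 < real N" by simp
    have eD: "e \<in> right_density_points E" using insert.prems(3) by (simp add: e_def)
    obtain \<alpha> \<beta> r where r: "0 < r"
      and aff: "\<And>k x' y'. k \<in> {1..N} - insert b S \<Longrightarrow> \<bar>x' - x\<bar> < r \<Longrightarrow> \<bar>y' - y\<bar> < r \<Longrightarrow>
        \<phi> (x' + real k * y') = \<alpha> k * (x' + real k * y') + \<beta> k"
      and out: "\<And>k x' y'. k \<in> {1..N} - insert b S \<Longrightarrow> \<bar>x' - x\<bar> < r \<Longrightarrow> \<bar>y' - y\<bar> < r \<Longrightarrow>
        x' + real k * y' \<notin> E"
      using affine_near_progression_terms[of "{1..N} - insert b S" x y \<phi> N] insert.prems(4) by blast
    show ?case
    proof (rule ccontr)
      assume none: "\<not> ?case"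
      define K where "K = (\<lambda>k. real k - real b) ` S"
      have "1 \<le> \<bar>\<kappa>\<bar> \<and> \<bar>\<kappa>\<bar> \<le> real N" if \<kappa>: "\<kappa> \<in> K" for \<kappa>
      proof -
        obtain k where k: "k \<in> S" "\<kappa> = real k - real b" using \<kappa> unfolding K_def by blast
        moreover have "k \<noteq> b" "k \<in> {1..N}" using k insert by auto
        ultimately show ?thesis using b by auto
      qed
      moreover have "e + \<kappa> * y \<in> right_density_points E" if \<kappa>: "\<kappa> \<in> K" for \<kappa>
      proof -
        obtain k where k: "k \<in> S" "\<kappa> = real k - real b" using \<kappa> unfolding K_def by blast
        have "e + \<kappa> * y = x + real k * y" unfolding e_def k(2) by (simp add: algebra_simps)
        then show ?thesis using insert.prems(3) k(1) by simp
      qed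
      moreover have "finite K" using insert.hyps unfolding K_def by simp
      ultimately obtain \<delta> where "\<delta> > 0" and \<delta>: "\<And>v. 0 < v \<Longrightarrow> v < \<delta> \<Longrightarrow>
        \<exists>s. 0 < s \<and> s < v / real N \<and> (\<forall>\<kappa>\<in>K. e + \<kappa> * y + v + \<kappa> * s \<in> right_density_points E)"
        using common_shift_into_density_points[OF closed_nonlinearity_set[of \<phi>] _ \<open>0 < real N\<close>, of K "\<lambda>\<kappa>. e + \<kappa> * y"]
        by blast
      define \<epsilon> where "\<epsilon> = min \<delta> (min (r / 2) \<bar>y\<bar>)"
      have \<epsilon>: "0 < \<epsilon>" "\<epsilon> \<le> \<delta>" "\<epsilon> \<le> r / 2" "\<epsilon> \<le> \<bar>y\<bar>"
        using \<open>\<delta> > 0\<close> r insert.prems(2) by (auto simp: \<epsilon>_def)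
      define T where "T = {1..N} - insert b S"
      \<comment> \<open>The line that a relation \<open>(c, d)\<close> prescribes for the graph at \<open>u\<close>.\<close>
      define line where "line = (\<lambda>(c :: nat \<Rightarrow> real, d). (- (\<Sum>k\<in>T. c k * \<alpha> k) / c b, (d - (\<Sum>k\<in>T. c k * \<beta> k)) / c b))"
      have line: "\<exists>(A, B)\<in>line ` C. \<phi> u = A * u + B" if u: "u \<in> {e<..<e + \<epsilon>}" "u \<notin> E" for u
      proof -
        define v where "v = u - e"
        have v: "0 < v" "v < \<epsilon>" using u by (auto simp: v_def)
        obtain s where s: "0 < s" "s < v / real N"
          and sK: "\<And>\<kappa>. \<kappa> \<in> K \<Longrightarrow> e + \<kappa> * y + v + \<kappa> * s \<in> right_density_points E"
          using \<delta>[of v] v \<epsilon> by auto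
        have bs: "0 < real b * s" "real b * s < v"
        proof -
          have "real b * s \<le> real N * s" using b s by (intro mult_right_mono) auto
          also have "\<dots> < real N * (v / real N)" using s \<open>0 < real N\<close> by (intro mult_strict_left_mono) auto
          finally show "real b * s < v" using \<open>0 < real N\<close> by simp
        qed (use b s in auto)
        have "1 * s \<le> real b * s" using b s by (intro mult_right_mono) auto
        then have "s < v" using bs by linarith
        define y1 where "y1 = y + s"
        define x1 where "x1 = u - real b * y1"
        have y1: "\<bar>y1 - y\<bar> < r" "y1 \<noteq> 0"
          using \<epsilon> v s(1) \<open>s < v\<close> unfolding y1_def by linarith+
        have "x1 - x = v - real b * s" unfolding x1_def y1_def v_def e_def by (simp add: algebra_simps)
        then have x1: "\<bar>x1 - x\<bar> < r" using bs v \<epsilon> by linarith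
        have "\<exists>c d r. (c, d) \<in> C \<and> (\<forall>k\<in>S. c k = 0) \<and> 0 < r \<and> box_related \<phi> N c d x1 y1 r"
        proof (rule insert.IH)
          show "S \<subseteq> {1..N}" using insert.prems(1) by simp
          show "y1 \<noteq> 0" by (rule y1)
          show "x1 + real k * y1 \<in> right_density_points E" if "k \<in> S" for k
          proof -
            have "x1 + real k * y1 = e + (real k - real b) * y + v + (real k - real b) * s"
              unfolding x1_def y1_def v_def by (simp add: algebra_simps)
            then show ?thesis using sK[of "real k - real b"] that unfolding K_def by simp
          qed
          show "x1 + real k * y1 \<notin> E" if "k \<in> {1..N} - S" for k
          proof (cases "k = b")
            case True
            then show ?thesis using u by (simp add: x1_def)
          next
            case False
            then show ?thesis using out x1 y1 that by simp
          qed
        qed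
        then obtain c d r1 where c: "(c, d) \<in> C" "\<And>k. k \<in> S \<Longrightarrow> c k = 0" "0 < r1"
          "box_related \<phi> N c d x1 y1 r1" by blast
        have "c b \<noteq> 0"
        proof
          assume "c b = 0"
          then have c0: "c k = 0" if "k \<in> insert b S" for k using c(2) that by auto
          have "box_related \<phi> N c d x y r"
            by (rule box_related_extends[OF aff c0 c(4,3) x1 y1(1)])
          then show False using none c \<open>c b = 0\<close> r by blast
        qed
        have ux: "u = x1 + real b * y1" by (simp add: x1_def)
        have "\<phi> u = (- (\<Sum>k\<in>T. c k * \<alpha> k) / c b) * u + (d - (\<Sum>k\<in>T. c k * \<beta> k)) / c b"
          by (rule value_determined_by_affine_terms[OF b insert.hyps(2) \<open>c b \<noteq> 0\<close> c(2) T_def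
                aff[folded T_def] c(4,3) x1 y1(1) ux])
        moreover have "(- (\<Sum>k\<in>T. c k * \<alpha> k) / c b, (d - (\<Sum>k\<in>T. c k * \<beta> k)) / c b) \<in> line ` C"
          unfolding line_def using c(1) by (intro image_eqI[of _ _ "(c, d)"]) auto
        ultimately show ?thesis by blast
      qed
      have "finite (E \<inter> {e<..<e + \<epsilon>})"
        by (rule finite_nonlinearity_set_if_linear_part_in_lines
            [OF cont open_greaterThanLessThan finite_imageI[OF fin] interior_nonlinearity_set line])
      then have "finite (insert e (E \<inter> {e<..<e + \<epsilon>}))" by simp
      moreover have "E \<inter> {e..e + \<epsilon> / 2} \<subseteq> insert e (E \<inter> {e<..<e + \<epsilon>})" using \<epsilon>(1) by auto
      ultimately have "finite (E \<inter> {e..e + \<epsilon> / 2})" using finite_subset by blast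
      then show False using right_density_point_infinite[OF eD, of "\<epsilon> / 2"] \<epsilon>(1) by simp
    qed
  qed
qed

text \<open>
  Near a density point there is a progression all of whose terms are density points. The relation
  obtained for it would have no term at all.
\<close>
lemma nonlinearity_set_null: "negligible E"
proof (rule ccontr)
  assume not_null: "\<not> negligible E"
  have "right_density_points E \<noteq> {}"
  proof
    assume none: "right_density_points E = {}"
    have "negligible (E - right_density_points E)"
      by (rule negligible_not_right_density_points[OF closed_nonlinearity_set])
    then show False using not_null unfolding none Diff_empty by contradiction
  qed
  then obtain t where t: "t \<in> right_density_points E" by blast
  have some_coefficient: "\<exists>k\<in>{1..N}. c k \<noteq> 0" if "(c, d) \<in> C" for c d
    using moments[OF that] by (metis (mono_tags, lifting) mult_eq_0_iff sum.neutral)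
  obtain c d where "(c, d) \<in> C" using related[of 1 0] by auto
  then have "0 < real N" using some_coefficient by fastforce
  moreover have "1 \<le> \<bar>\<kappa>\<bar> \<and> \<bar>\<kappa>\<bar> \<le> real N" if "\<kappa> \<in> real ` {1..N}" for \<kappa> using that by auto
  ultimately obtain \<delta> where "\<delta> > 0" and \<delta>: "\<And>v. 0 < v \<Longrightarrow> v < \<delta> \<Longrightarrow>
      \<exists>s. 0 < s \<and> s < v / real N \<and> (\<forall>\<kappa>\<in>real ` {1..N}. t + v + \<kappa> * s \<in> right_density_points E)"
    using common_shift_into_density_points[OF closed_nonlinearity_set[of \<phi>], of "real ` {1..N}" "real N" "\<lambda>_. t"] t
    by blast
  obtain s where "0 < s" "\<forall>\<kappa>\<in>real ` {1..N}. t + \<delta> / 2 + \<kappa> * s \<in> right_density_points E"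
    using \<delta>[of "\<delta> / 2"] \<open>\<delta> > 0\<close> by auto
  then obtain c d where "(c, d) \<in> C" "\<forall>k\<in>{1..N}. c k = 0"
    using relation_among_affine_terms[of "{1..N}" s "t + \<delta> / 2"] by auto
  then show False using some_coefficient by blast
qed

end

section \<open>Adding a generic progression\<close>

text \<open>
  Injectivity on \<open>A\<close> and distinct sums of pairs for the image in one condition: the case
  \<open>a = b\<close>, \<open>c = d\<close> gives injectivity.
\<close>
definition distinct_image_sums :: "(real \<Rightarrow> real) \<Rightarrow> real set \<Rightarrow> bool" where
  "distinct_image_sums \<phi> A \<longleftrightarrow>
     (\<forall>a\<in>A. \<forall>b\<in>A. \<forall>c\<in>A. \<forall>d\<in>A.
        \<phi> a + \<phi> b = \<phi> c + \<phi> d \<longrightarrow> (a = c \<and> b = d) \<or> (a = d \<and> b = c))"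

lemma distinct_image_sumsD:
  assumes "distinct_image_sums \<phi> A" "a \<in> A" "b \<in> A" "c \<in> A" "d \<in> A" "\<phi> a + \<phi> b = \<phi> c + \<phi> d"
  shows "(a = c \<and> b = d) \<or> (a = d \<and> b = c)"
  using assms unfolding distinct_image_sums_def by blast

lemma distinct_image_sums_inj_on:
  assumes "distinct_image_sums \<phi> A"
  shows "inj_on \<phi> A"
proof (rule inj_onI)
  fix a b assume "a \<in> A" "b \<in> A" "\<phi> a = \<phi> b"
  then show "a = b" using distinct_image_sumsD[OF assms, of a a b b] by auto
qed

lemma distinct_image_sums_imp_distinct_pair_sums:
  assumes "distinct_image_sums \<phi> A"
  shows "distinct_pair_sums (\<phi> ` A)"
  using assms unfolding distinct_pair_sums_def distinct_image_sums_def by blast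

lemma pair_determined_by_sum_and_square_sum:
  fixes a b c d :: real
  assumes "a + b = c + d" "a\<^sup>2 + b\<^sup>2 = c\<^sup>2 + d\<^sup>2"
  shows "(a = c \<and> b = d) \<or> (a = d \<and> b = c)"
proof -
  have "(a - c) * (a - d) = 0" using assms by algebra
  then show ?thesis using assms(1) by auto
qed

lemma generic_progression:
  assumes "continuous_on UNIV \<phi>" "\<not> negligible (nonlinearity_set \<phi>)" "finite C"
    and "\<And>c d. (c, d) \<in> C \<Longrightarrow> card {k\<in>{1..N}. c k \<noteq> 0} \<le> 4"
    and "\<And>c d. (c, d) \<in> C \<Longrightarrow> \<exists>j\<le>2. (\<Sum>k\<in>{1..N}. c k * real k ^ j) \<noteq> 0"
  shows "\<exists>x y. y \<noteq> 0 \<and> (\<forall>(c, d)\<in>C. combination \<phi> N c x y \<noteq> d)"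
proof (rule ccontr)
  assume "\<not> ?thesis"
  then have "everywhere_related \<phi> N C"
    using assms by unfold_locales (auto simp: split_def)
  then show False using everywhere_related.nonlinearity_set_null assms(2) by blast
qed

text \<open>
  An equality between sums of pairs of values on \<open>A \<union> F\<close> is a relation for the progression
  \<open>F\<close>, with the values on \<open>A\<close> moved to the constant term. If the three moments of its
  coefficients vanish, then both sides contain the same number of terms of \<open>F\<close>, with equal
  sums and equal sums of squares of their indices, hence the same terms. So a progression that
  avoids the relations with some nonvanishing moment is good.
\<close>
lemma distinct_image_sums_extend:
  assumes "continuous_on UNIV \<phi>" "\<not> negligible (nonlinearity_set \<phi>)"
    and "finite A" and A: "distinct_image_sums \<phi> A"
  shows "\<exists>F. arith_progression N F \<and> distinct_image_sums \<phi> (A \<union> F)"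
proof -
  \<comment> \<open>Summands are addressed by \<open>Inl k\<close>, the term number \<open>k\<close> of \<open>F\<close>, or \<open>Inr a\<close> with \<open>a \<in> A\<close>.\<close>
  define I :: "(nat + real) set" where "I = Inl ` {1..N} \<union> Inr ` A"
  define point :: "real \<Rightarrow> real \<Rightarrow> nat + real \<Rightarrow> real"
    where "point x y i = (case i of Inl k \<Rightarrow> x + real k * y | Inr a \<Rightarrow> a)" for x y i
  define coeff :: "nat + real \<Rightarrow> nat \<Rightarrow> real"
    where "coeff i k = (case i of Inl l \<Rightarrow> if k = l then 1 else 0 | Inr a \<Rightarrow> 0)" for i k
  define const :: "nat + real \<Rightarrow> real"
    where "const i = (case i of Inl k \<Rightarrow> 0 | Inr a \<Rightarrow> \<phi> a)" for i
  define moment :: "nat \<Rightarrow> nat + real \<Rightarrow> real"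
    where "moment j i = (case i of Inl k \<Rightarrow> real k ^ j | Inr a \<Rightarrow> 0)" for j i
  define lhs where "lhs = (\<lambda>(i1, i2, i3, i4) k. coeff i1 k + coeff i2 k - coeff i3 k - coeff i4 k)"
  define rhs where "rhs = (\<lambda>(i1, i2, i3, i4). const i3 + const i4 - const i1 - const i2)"
  define C where "C = (\<lambda>q. (lhs q, rhs q)) `
     {q \<in> I \<times> I \<times> I \<times> I. \<exists>j\<le>2. (\<Sum>k\<in>{1..N}. lhs q k * real k ^ j) \<noteq> 0}"
  have coeff_sum: "(\<Sum>k\<in>{1..N}. coeff i k * f k) = (case i of Inl l \<Rightarrow> f l | Inr a \<Rightarrow> 0)"
    if "i \<in> I" for i and f :: "nat \<Rightarrow> real"
  proof (cases i)
    case (Inl l)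
    then have "l \<in> {1..N}" using that unfolding I_def by auto
    have "(\<Sum>k\<in>{1..N}. coeff i k * f k) = (\<Sum>k\<in>{1..N}. if k = l then f k else 0)"
      unfolding coeff_def Inl by (intro sum.cong) auto
    then show ?thesis using \<open>l \<in> {1..N}\<close> Inl by simp
  qed (simp add: coeff_def)
  have lhs_sum: "(\<Sum>k\<in>{1..N}. lhs (i1, i2, i3, i4) k * f k) =
      (\<Sum>k\<in>{1..N}. coeff i1 k * f k) + (\<Sum>k\<in>{1..N}. coeff i2 k * f k)
      - (\<Sum>k\<in>{1..N}. coeff i3 k * f k) - (\<Sum>k\<in>{1..N}. coeff i4 k * f k)"
    for i1 i2 i3 i4 and f :: "nat \<Rightarrow> real"
    unfolding lhs_def by (simp add: algebra_simps sum.distrib sum_subtractf)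
  have moment: "(\<Sum>k\<in>{1..N}. coeff i k * real k ^ j) = moment j i" if "i \<in> I" for i j
    unfolding coeff_sum[OF that] moment_def ..
  have term_val: "(\<Sum>k\<in>{1..N}. coeff i k * \<phi> (x + real k * y)) = \<phi> (point x y i) - const i" if "i \<in> I" for i x y
    unfolding coeff_sum[OF that] point_def const_def by (cases i) auto
  have "finite C" unfolding C_def I_def using \<open>finite A\<close> by simp
  moreover have "card {k\<in>{1..N}. c k \<noteq> 0} \<le> 4" if C: "(c, d) \<in> C" for c d
  proof -
    obtain i1 i2 i3 i4 where c: "c = lhs (i1, i2, i3, i4)" using C unfolding C_def by auto
    define l :: "nat + real \<Rightarrow> nat" where "l i = (case i of Inl k \<Rightarrow> k | Inr a \<Rightarrow> 0)" for i
    have l: "coeff i k = 0" if "k \<noteq> l i" for i k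
      using that unfolding coeff_def l_def by (cases i) auto
    have "{k\<in>{1..N}. c k \<noteq> 0} \<subseteq> set [l i1, l i2, l i3, l i4]"
      unfolding c lhs_def using l by fastforce
    then have "card {k\<in>{1..N}. c k \<noteq> 0} \<le> card (set [l i1, l i2, l i3, l i4])"
      by (intro card_mono) auto
    also have "\<dots> \<le> length [l i1, l i2, l i3, l i4]" by (rule card_length)
    finally show ?thesis by simp
  qed
  moreover have "\<exists>j\<le>2. (\<Sum>k\<in>{1..N}. c k * real k ^ j) \<noteq> 0" if "(c, d) \<in> C" for c d
    using that unfolding C_def by blast
  ultimately obtain x y where "y \<noteq> 0" and generic: "\<And>c d. (c, d) \<in> C \<Longrightarrow> combination \<phi> N c x y \<noteq> d"
    using generic_progression[OF assms(1,2), of C N] by blast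
  define F where "F = {x + real k * y | k. k \<in> {1..N}}"
  have "arith_progression N F" unfolding arith_progression_def F_def using \<open>y \<noteq> 0\<close> by blast
  have points: "\<exists>i\<in>I. point x y i = a" if "a \<in> A \<union> F" for a
    using that unfolding F_def I_def point_def by force
  have "distinct_image_sums \<phi> (A \<union> F)"
    unfolding distinct_image_sums_def
  proof (intro ballI impI)
    fix a1 a2 a3 a4
    assume a: "a1 \<in> A \<union> F" "a2 \<in> A \<union> F" "a3 \<in> A \<union> F" "a4 \<in> A \<union> F"
      and eq: "\<phi> a1 + \<phi> a2 = \<phi> a3 + \<phi> a4"
    obtain i1 i2 i3 i4 where i: "i1 \<in> I" "i2 \<in> I" "i3 \<in> I" "i4 \<in> I"
      and p: "a1 = point x y i1" "a2 = point x y i2" "a3 = point x y i3" "a4 = point x y i4"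
      using points[OF a(1)] points[OF a(2)] points[OF a(3)] points[OF a(4)] by metis
    let ?q = "(i1, i2, i3, i4)"
    have "combination \<phi> N (lhs ?q) x y = rhs ?q"
      unfolding combination_def lhs_sum term_val[OF i(1)] term_val[OF i(2)] term_val[OF i(3)] term_val[OF i(4)]
      using eq by (simp add: rhs_def p)
    then have "(lhs ?q, rhs ?q) \<notin> C" using generic by blast
    then have "(\<Sum>k\<in>{1..N}. lhs ?q k * real k ^ j) = 0" if "j \<le> 2" for j
      using that i unfolding C_def by auto
    then have m: "moment j i1 + moment j i2 = moment j i3 + moment j i4" if "j \<le> 2" for j
      using that unfolding lhs_sum moment[OF i(1)] moment[OF i(2)] moment[OF i(3)] moment[OF i(4)]
      by (simp add: algebra_simps)
    have inA: "a \<in> A" if "Inr a \<in> I" for a using that unfolding I_def by auto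
    note inj = inj_onD[OF distinct_image_sums_inj_on[OF A]]
    note sums = distinct_image_sumsD[OF A]
    note pair = pair_determined_by_sum_and_square_sum
    note m' = m[of 0, unfolded moment_def] m[of 1, unfolded moment_def] m[of 2, unfolded moment_def]
    show "(a1 = a3 \<and> a2 = a4) \<or> (a1 = a4 \<and> a2 = a3)"
    \<comment> \<open>The moment of order 0 excludes different numbers of terms of \<open>F\<close> on the two sides.\<close>
    proof (cases i1; cases i2; cases i3; cases i4)
      fix k1 k2 k3 k4 assume k: "i1 = Inl k1" "i2 = Inl k2" "i3 = Inl k3" "i4 = Inl k4"
      then show ?thesis using pair[of "real k1" "real k2" "real k3" "real k4"] m' p
        by (auto simp: point_def)
    next
      fix b1 b2 b3 b4 assume k: "i1 = Inr b1" "i2 = Inr b2" "i3 = Inr b3" "i4 = Inr b4"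
      then show ?thesis using sums[of b1 b2 b3 b4] eq p i inA by (simp add: point_def)
    qed (use m' p eq i inA inj in \<open>auto simp: point_def\<close>)
  qed
  then show ?thesis using \<open>arith_progression N F\<close> by blast
qed

theorem mainTheorem1:
  fixes \<phi> :: "real \<Rightarrow> real"
  assumes "continuous_on UNIV \<phi>"
    and "emeasure lebesgue (nonlinearity_set \<phi>) \<noteq> 0"
  shows "\<exists>A B. arbitrarily_long_progressions A \<and> distinct_pair_sums B \<and> bij_betw \<phi> A B"
proof -
  have "\<not> negligible (nonlinearity_set \<phi>)"
    using assms(2) by (auto simp: negligible_iff_null_sets null_sets_def)
  note extend = distinct_image_sums_extend[OF assms(1) this]
  have "\<exists>f. \<forall>n. (finite (f n) \<and> distinct_image_sums \<phi> (f n)) \<and>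
      (\<exists>F. arith_progression n F \<and> f (Suc n) = f n \<union> F)"
  proof (rule dependent_nat_choice)
    show "\<exists>A. finite A \<and> distinct_image_sums \<phi> A"
      by (intro exI[of _ "{}"]) (simp add: distinct_image_sums_def)
    fix A n assume A: "finite A \<and> distinct_image_sums \<phi> A"
    then obtain F where F: "arith_progression n F" "distinct_image_sums \<phi> (A \<union> F)"
      using extend by blast
    then have "finite F" unfolding arith_progression_def by auto
    then show "\<exists>A'. (finite A' \<and> distinct_image_sums \<phi> A') \<and> (\<exists>F. arith_progression n F \<and> A' = A \<union> F)"
      using A F by blast
  qed
  then obtain f where f: "\<And>n. distinct_image_sums \<phi> (f n)"
    "\<And>n. \<exists>F. arith_progression n F \<and> f (Suc n) = f n \<union> F" by metis
  define A where "A = (\<Union>n. f n)"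
  have mono: "f m \<subseteq> f n" if "m \<le> n" for m n
    using f(2) by (intro lift_Suc_mono_le[OF _ that]) blast
  have "arbitrarily_long_progressions A"
    unfolding arbitrarily_long_progressions_def A_def using f(2) by blast
  moreover have "distinct_image_sums \<phi> A"
    unfolding distinct_image_sums_def
  proof (intro ballI)
    fix a b c d assume "a \<in> A" "b \<in> A" "c \<in> A" "d \<in> A"
    then obtain na nb nc nd where "a \<in> f na" "b \<in> f nb" "c \<in> f nc" "d \<in> f nd"
      unfolding A_def by blast
    then have n: "a \<in> f (na + nb + nc + nd)" "b \<in> f (na + nb + nc + nd)"
      "c \<in> f (na + nb + nc + nd)" "d \<in> f (na + nb + nc + nd)"
      using mono[of na "na + nb + nc + nd"] mono[of nb "na + nb + nc + nd"]
        mono[of nc "na + nb + nc + nd"] mono[of nd "na + nb + nc + nd"] by auto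
    show "\<phi> a + \<phi> b = \<phi> c + \<phi> d \<longrightarrow> (a = c \<and> b = d) \<or> (a = d \<and> b = c)"
      using distinct_image_sumsD[OF f(1) n] by blast
  qed
  ultimately show ?thesis
    using distinct_image_sums_imp_distinct_pair_sums distinct_image_sums_inj_on
    unfolding bij_betw_def by blast
qed

end
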